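(* Let $G$ be a locally compact group with left Haar measure $\mathrm{m}$. Then the following are equivalent: (i) $G$ is amenable; (ii) for every $\varepsilon>0$, there exists $n_\varepsilon\in\mathbb{N}$ such that for every finite subset $F\subseteq G$ there exists a compact subset $C\subseteq G$ with the property that $$\mathrm{m}(EC)<\varepsilon\,|E|\,\mathrm{m}(C)\qquad\text{for every } E\subseteq F \text{ with } |E|\ge n_\varepsilon .$$
   Context: $\mathbb{N}=\{1,2,\ldots\}$; $|E|$ is the cardinality of a finite set $E$, and $EC=\{tc: t\in E, c\in C\}$. $L^\infty(G)$ is identified with the dual of $L^1(G)=L^1(G,\mathrm{m})$. A locally compact group $G$ is amenable if there is a left-invariant mean on $L^\infty(G)$, i.e. a positive linear functional $\Lambda:L^\infty(G)\to\mathbb{C}$ with $\Lambda(\mathbf{1})=1$ and $\delta_s\cdot\Lambda=\Lambda$ for all $s\in G$, where $(\delta_s\cdot\Lambda)(\varphi)=\Lambda(\varphi\cdot\delta_s)$ and $(\varphi\cdot\delta_s)(x)=\varphi(sx)$. *)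

theory Defs
  imports "HOL-Analysis.Analysis"
begin

(* Groups are written additively: group_add does not assume commutativity, and
   topological_group_add is the topological group class of the library. So s + x is the
   product sx, and E + C (from Set_Algebras) is the product set EC. *)

definition left_haar_measure ::
    "'a::{topological_group_add, t2_space} measure \<Rightarrow> bool" where
  "left_haar_measure m \<longleftrightarrow>
     sets m = sets borel \<and>
     emeasure m UNIV \<noteq> 0 \<and>
     (\<forall>K. compact K \<longrightarrow> emeasure m K < \<infinity>) \<and>
     (\<forall>A\<in>sets borel. emeasure m A = (INF U\<in>{U. open U \<and> A \<subseteq> U}. emeasure m U)) \<and>
     (\<forall>U. open U \<longrightarrow> emeasure m U = (SUP K\<in>{K. compact K \<and> K \<subseteq> U}. emeasure m K)) \<and>
     (\<forall>s. \<forall>A\<in>sets borel. emeasure m ((\<lambda>x. s + x) ` A) = emeasure m A)"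

(* A Haar measure need not be sigma-finite. For the identification of the dual of L^1 with
   L^infinity to hold in general, the latter has to consist of the locally measurable, locally
   essentially bounded functions, modulo equality locally almost everywhere; "locally" means
   on every measurable set of finite measure. *)

definition locally_AE :: "'a measure \<Rightarrow> ('a \<Rightarrow> bool) \<Rightarrow> bool" where
  "locally_AE m P \<longleftrightarrow> (\<forall>A\<in>sets m. emeasure m A < \<infinity> \<longrightarrow> (AE x\<in>A in m. P x))"

definition locally_measurable :: "'a measure \<Rightarrow> ('a \<Rightarrow> complex) \<Rightarrow> bool" where
  "locally_measurable m \<phi> \<longleftrightarrow>
     (\<forall>A\<in>sets m. emeasure m A < \<infinity> \<longrightarrow> \<phi> \<in> borel_measurable (restrict_space m A))"

definition L_infinity :: "'a measure \<Rightarrow> ('a \<Rightarrow> complex) set" where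
  "L_infinity m = {\<phi>. locally_measurable m \<phi> \<and> (\<exists>c. locally_AE m (\<lambda>x. norm (\<phi> x) \<le> c))}"

(* Elements of the quotient are given by representatives; the first condition says that
   \<Lambda> descends to the quotient. Values of \<Lambda> outside L_infinity m are irrelevant. *)

definition linear_functional_on_L_infinity ::
    "'a measure \<Rightarrow> (('a \<Rightarrow> complex) \<Rightarrow> complex) \<Rightarrow> bool" where
  "linear_functional_on_L_infinity m \<Lambda> \<longleftrightarrow>
     (\<forall>\<phi>\<in>L_infinity m. \<forall>\<psi>\<in>L_infinity m. locally_AE m (\<lambda>x. \<phi> x = \<psi> x) \<longrightarrow> \<Lambda> \<phi> = \<Lambda> \<psi>) \<and>
     (\<forall>\<phi>\<in>L_infinity m. \<forall>\<psi>\<in>L_infinity m. \<Lambda> (\<lambda>x. \<phi> x + \<psi> x) = \<Lambda> \<phi> + \<Lambda> \<psi>) \<and>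
     (\<forall>c. \<forall>\<phi>\<in>L_infinity m. \<Lambda> (\<lambda>x. c * \<phi> x) = c * \<Lambda> \<phi>)"

definition mean_on_L_infinity ::
    "'a measure \<Rightarrow> (('a \<Rightarrow> complex) \<Rightarrow> complex) \<Rightarrow> bool" where
  "mean_on_L_infinity m \<Lambda> \<longleftrightarrow>
     linear_functional_on_L_infinity m \<Lambda> \<and>
     (\<forall>\<phi>\<in>L_infinity m. locally_AE m (\<lambda>x. \<phi> x \<in> \<real>\<^sub>\<ge>\<^sub>0) \<longrightarrow> \<Lambda> \<phi> \<in> \<real>\<^sub>\<ge>\<^sub>0) \<and>
     \<Lambda> (\<lambda>x. 1) = 1"

definition amenable :: "'a::{topological_group_add, t2_space} measure \<Rightarrow> bool" where
  "amenable m \<longleftrightarrow>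
     (\<exists>\<Lambda>. mean_on_L_infinity m \<Lambda> \<and>
          (\<forall>s. \<forall>\<phi>\<in>L_infinity m. \<Lambda> (\<lambda>x. \<phi> (s + x)) = \<Lambda> \<phi>))"

end

theory Submission
  imports Defs
begin

text \<open>
  From (ii) to amenability, only \<open>\<epsilon> = 1/2\<close> is needed: a maximal subset \<open>E\<close> of \<open>F\<close> whose translates
  \<open>s + C\<close> have small pairwise overlaps must have fewer than \<open>n\<close> elements, so every translate
  \<open>s + C\<close> with \<open>s \<in> F\<close> substantially overlaps one of boundedly many. If there were no almost
  invariant densities, averaging over some finite set \<open>S\<close> would contract the norm of
  \<open>L\<^sup>2\<close> by a fixed factor (Kesten); taking for \<open>F\<close> all \<open>k\<close>-fold sums from \<open>S\<close>, the average of
  these overlaps would tend to \<open>0\<close> as \<open>k\<close> grows. Almost invariant densities yield an invariant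
  mean by compactness.

  Conversely, let \<open>K\<close> be compact of positive measure. If no convex combination of indicators of
  translates of \<open>K\<close> is almost invariant, a minimax argument and compactness produce functions
  \<open>\<phi>\<^sub>s\<close> (\<open>s \<in> F\<close>) for which the sum of \<open>\<phi>\<^sub>s(s + x) - \<phi>\<^sub>s(x)\<close> over \<open>s\<close> is bounded below by a
  positive constant. All candidates are equicontinuous because they are integrals against
  translates of the indicator of \<open>K\<close>, so the limit is continuous and an invariant mean may be
  applied to it, a contradiction. A superlevel set \<open>C\<close> of an almost invariant combination is a
  Foelner set, for which \<open>E + C\<close> has measure less than twice that of \<open>C\<close>.
\<close>

section \<open>Integration on the group\<close>

text \<open>Left translation by \<open>s\<close> is a bijection with inverse translation by
  \<open>- s\<close>. In preimage form, measurability of translates follows from that of the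
  translation maps.\<close>

lemma image_add_eq_vimage: "(+) s ` A = (\<lambda>x. - s + x) -` A" for s :: "'a::group_add"
  by (auto simp: image_iff add.assoc[symmetric] intro!: bexI[where x="- s + _"])

lemma set_plus_eq_UN: "E + C = (\<Union>s\<in>E. (+) s ` C)"
  by (auto simp: set_plus_def)

locale haar =
  fixes m :: "'a::{topological_group_add, t2_space} measure"
  assumes haar: "left_haar_measure m"
begin

section \<open>Measurability and invariance under left translation\<close>

lemma sets_m [simp, measurable_cong]: "sets m = sets borel"
  using haar by (simp add: left_haar_measure_def)

lemma space_m [simp]: "space m = UNIV"
  using sets_eq_imp_space_eq[OF sets_m] by simp

lemma continuous_translate: "continuous_on UNIV ((+) s)" for s :: 'a
  by (intro continuous_intros)

lemma measurable_translate [measurable]: "(+) s \<in> borel \<rightarrow>\<^sub>M borel" for s :: 'a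
  by (intro borel_measurable_continuous_onI continuous_translate)

lemma translate_borel: "A \<in> sets borel \<Longrightarrow> (+) s ` A \<in> sets borel" for s :: 'a
  using measurable_sets[OF measurable_translate, of A "- s"] by (simp add: image_add_eq_vimage)

lemma emeasure_translate: "A \<in> sets borel \<Longrightarrow> emeasure m ((+) s ` A) = emeasure m A"
  using haar by (simp add: left_haar_measure_def)

lemma measure_translate: "A \<in> sets borel \<Longrightarrow> measure m ((+) s ` A) = measure m A"
  by (simp add: measure_def emeasure_translate)

lemma distr_translate: "distr m m ((+) s) = m"
proof (rule measure_eqI)
  fix A assume "A \<in> sets (distr m m ((+) s))"
  then have A: "A \<in> sets borel" by simp
  have "emeasure (distr m m ((+) s)) A = emeasure m ((+) s -` A)"
    using A by (subst emeasure_distr) auto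
  also have "(+) s -` A = (+) (- s) ` A" by (simp add: image_add_eq_vimage)
  finally show "emeasure (distr m m ((+) s)) A = emeasure m A"
    using A by (simp add: emeasure_translate)
qed simp

lemma integral_translate:
  fixes h :: "'a \<Rightarrow> 'b::{banach, second_countable_topology}"
  assumes "h \<in> borel_measurable m"
  shows "(\<integral>x. h (s + x) \<partial>m) = (\<integral>x. h x \<partial>m)"
proof -
  have "(\<integral>x. h x \<partial>distr m m ((+) s)) = (\<integral>x. h (s + x) \<partial>m)"
    using assms by (intro integral_distr) auto
  then show ?thesis by (simp add: distr_translate)
qed

lemma compact_finite: "compact K \<Longrightarrow> emeasure m K < \<infinity>"
  using haar unfolding left_haar_measure_def by blast

lemma compact_borel: "compact K \<Longrightarrow> K \<in> sets borel" for K :: "'a set"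
  by (simp add: borel_closed compact_imp_closed)

lemma compact_translate: "compact K \<Longrightarrow> compact ((+) s ` K)" for K :: "'a set"
  by (meson compact_continuous_image continuous_on_subset continuous_translate top_greatest)

lemma compact_fmeasurable: "compact K \<Longrightarrow> K \<in> fmeasurable m"
  using compact_finite by (auto simp: fmeasurable_def compact_borel)

text \<open>Inner regularity on the open set \<open>UNIV\<close>: if all compact sets were null, so
  would be their supremum, the measure of the whole group.\<close>

lemma exists_compact_pos: "\<exists>K. compact K \<and> measure m K > 0"
proof (rule ccontr)
  assume "\<not> ?thesis"
  then have *: "compact K \<Longrightarrow> emeasure m K = 0" for K
    using compact_finite[of K] by (simp add: not_less measure_le_0_iff emeasure_eq_measure2
        emeasure_eq_ennreal_measure order.strict_iff_not)
  have "emeasure m UNIV = (SUP K\<in>{K. compact K \<and> K \<subseteq> UNIV}. emeasure m K)"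
    using haar unfolding left_haar_measure_def by (meson open_UNIV)
  also have "\<dots> \<le> 0" by (rule SUP_least) (use * in auto)
  finally show False using haar by (simp add: left_haar_measure_def)
qed

text \<open>The class serves for all densities and \<open>L^2\<close> functions at once. Boundedness
  makes it closed under products and squares; a carrier of finite measure gives integrability and
  lets local properties of \<open>L_infinity\<close> functions be used although \<open>m\<close>
  need not be sigma-finite.\<close>

definition test_fun :: "('a \<Rightarrow> real) \<Rightarrow> bool" where
  "test_fun f \<longleftrightarrow> f \<in> borel_measurable m \<and> (\<exists>B. \<forall>x. \<bar>f x\<bar> \<le> B) \<and>
     (\<exists>A\<in>sets m. emeasure m A < \<infinity> \<and> (\<forall>x. x \<notin> A \<longrightarrow> f x = 0))"

lemma test_funI:
  assumes "f \<in> borel_measurable m" "\<And>x. \<bar>f x\<bar> \<le> B"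
    and "A \<in> sets m" "emeasure m A < \<infinity>" "\<And>x. x \<notin> A \<Longrightarrow> f x = 0"
  shows "test_fun f"
  using assms unfolding test_fun_def by blast

lemma test_funE:
  assumes "test_fun f"
  obtains A B where "f \<in> borel_measurable m" "\<And>x. \<bar>f x\<bar> \<le> B" "B \<ge> 0"
    "A \<in> sets m" "emeasure m A < \<infinity>" "\<And>x. x \<notin> A \<Longrightarrow> f x = 0"
proof -
  obtain A B where "f \<in> borel_measurable m" and B: "\<And>x. \<bar>f x\<bar> \<le> B"
    and "A \<in> sets m" "emeasure m A < \<infinity>" "\<And>x. x \<notin> A \<Longrightarrow> f x = 0"
    using assms unfolding test_fun_def by blast
  moreover have "B \<ge> 0" using B[of 0] by linarith
  ultimately show thesis using that by blast
qed

lemma test_fun_measurable [measurable_dest]: "test_fun f \<Longrightarrow> f \<in> borel_measurable m"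
  by (simp add: test_fun_def)

lemma test_fun_integrable: "test_fun f \<Longrightarrow> integrable m f"
  by (erule test_funE, rule integrableI_bounded_set) auto

lemma test_fun_indicator:
  "A \<in> fmeasurable m \<Longrightarrow> test_fun (indicator A)"
  by (rule test_funI[of _ 1 A]) (auto simp: fmeasurable_def indicator_def)

lemma test_fun_add:
  assumes "test_fun f" "test_fun g" shows "test_fun (\<lambda>x. f x + g x)"
proof -
  obtain A B where f: "f \<in> borel_measurable m" "\<And>x. \<bar>f x\<bar> \<le> B"
    "A \<in> sets m" "emeasure m A < \<infinity>" "\<And>x. x \<notin> A \<Longrightarrow> f x = 0"
    using assms(1) by (rule test_funE) blast
  obtain A' B' where g: "g \<in> borel_measurable m" "\<And>x. \<bar>g x\<bar> \<le> B'"
    "A' \<in> sets m" "emeasure m A' < \<infinity>" "\<And>x. x \<notin> A' \<Longrightarrow> g x = 0"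
    using assms(2) by (rule test_funE) blast
  have "emeasure m (A \<union> A') \<le> emeasure m A + emeasure m A'"
    using f(3) g(3) by (intro emeasure_subadditive) auto
  also have "\<dots> < \<infinity>" using f(4) g(4) by simp
  finally have "emeasure m (A \<union> A') < \<infinity>" .
  moreover have "\<bar>f x + g x\<bar> \<le> B + B'" for x using f(2)[of x] g(2)[of x] by linarith
  ultimately show ?thesis using f g by (intro test_funI[of _ "B + B'" "A \<union> A'"]) auto
qed

lemma test_fun_mult:
  assumes f: "test_fun f" and g: "g \<in> borel_measurable m" "\<And>x. \<bar>g x\<bar> \<le> D"
  shows "test_fun (\<lambda>x. f x * g x)" "test_fun (\<lambda>x. g x * f x)"
proof -
  obtain A B where f: "f \<in> borel_measurable m" "\<And>x. \<bar>f x\<bar> \<le> B" "B \<ge> 0"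
    "A \<in> sets m" "emeasure m A < \<infinity>" "\<And>x. x \<notin> A \<Longrightarrow> f x = 0"
    using f by (rule test_funE) blast
  have "\<bar>f x * g x\<bar> \<le> B * D" for x
    unfolding abs_mult by (intro mult_mono f g) (auto simp: f)
  then show "test_fun (\<lambda>x. f x * g x)"
    using f g by (intro test_funI[of _ "B * D" A]) auto
  then show "test_fun (\<lambda>x. g x * f x)" by (simp add: mult.commute)
qed

lemma test_fun_times: "test_fun f \<Longrightarrow> test_fun g \<Longrightarrow> test_fun (\<lambda>x. f x * g x)"
  by (erule test_funE[of g]) (rule test_fun_mult)

lemma test_fun_scale: "test_fun f \<Longrightarrow> test_fun (\<lambda>x. c * f x)"
  using test_fun_mult(2)[of f "\<lambda>_. c" "\<bar>c\<bar>"] by simp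

lemma test_fun_diff: "test_fun f \<Longrightarrow> test_fun g \<Longrightarrow> test_fun (\<lambda>x. f x - g x)"
  using test_fun_add[of f "\<lambda>x. -1 * g x", OF _ test_fun_scale] by simp

lemma test_fun_abs: "test_fun f \<Longrightarrow> test_fun (\<lambda>x. \<bar>f x\<bar>)"
  by (erule test_funE) (rule test_funI, auto)

lemma test_fun_power2: "test_fun f \<Longrightarrow> test_fun (\<lambda>x. (f x)\<^sup>2)"
  using test_fun_times[of f f] by (simp add: power2_eq_square)

lemma test_fun_zero: "test_fun (\<lambda>x. 0)"
  by (rule test_funI[of _ 0 "{}"]) auto

lemma test_fun_sum: "(\<And>i. i \<in> I \<Longrightarrow> test_fun (f i)) \<Longrightarrow> test_fun (\<lambda>x. \<Sum>i\<in>I. f i x)"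
  by (induction I rule: infinite_finite_induct) (auto intro: test_fun_zero test_fun_add)

lemma test_fun_translate:
  assumes "test_fun f" shows "test_fun (\<lambda>x. f (s + x))"
proof -
  obtain A B where f: "f \<in> borel_measurable m" "\<And>x. \<bar>f x\<bar> \<le> B"
    "A \<in> sets m" "emeasure m A < \<infinity>" "\<And>x. x \<notin> A \<Longrightarrow> f x = 0"
    using assms by (rule test_funE) blast
  then have "emeasure m ((+) (- s) ` A) < \<infinity>" "(+) (- s) ` A \<in> sets m"
    using emeasure_translate translate_borel by auto
  moreover have "(\<lambda>x. f (s + x)) \<in> borel_measurable m"
    using f(1) by measurable
  ultimately show ?thesis using f
    by (intro test_funI[of _ B "(+) (- s) ` A"]) (auto simp: image_add_eq_vimage)
qed

lemmas test_fun_intros = test_fun_add test_fun_scale test_fun_diff test_fun_abs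
  test_fun_power2 test_fun_sum

end

section \<open>Contraction of averages\<close>

text \<open>The mean of the squares exceeds the square of the mean by the variance
  \<open>V / N\<close>. Comparing \<open>a s\<close> and \<open>a z\<close> through the mean bounds
  each squared difference by \<open>2 * V\<close>, so the variance controls all deviations from the
  single value \<open>a z\<close>.\<close>

lemma average_power2_le:
  fixes a :: "'b \<Rightarrow> real"
  assumes "finite S" "z \<in> S"
  defines "N \<equiv> real (card S)"
  shows "((\<Sum>s\<in>S. a s) / N)\<^sup>2 \<le> (\<Sum>s\<in>S. (a s)\<^sup>2) / N - (\<Sum>s\<in>S. (a s - a z)\<^sup>2) / (2 * N\<^sup>2)"
proof -
  define b where "b = (\<Sum>s\<in>S. a s) / N"
  define V where "V = (\<Sum>s\<in>S. (a s - b)\<^sup>2)"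
  have "N > 0" using assms by (auto simp: N_def card_gt_0_iff)
  then have sum_a: "(\<Sum>s\<in>S. a s) = N * b" by (simp add: b_def)
  have "V = (\<Sum>s\<in>S. (a s)\<^sup>2 - 2 * b * a s + b\<^sup>2)"
    unfolding V_def by (intro sum.cong) (auto simp: power2_diff)
  also have "\<dots> = (\<Sum>s\<in>S. (a s)\<^sup>2) - N * b\<^sup>2"
    by (simp add: sum.distrib sum_subtractf sum_distrib_left[symmetric] sum_a)
      (simp add: power2_eq_square N_def)
  finally have V: "V = (\<Sum>s\<in>S. (a s)\<^sup>2) - N * b\<^sup>2" .
  have "(a s - a z)\<^sup>2 \<le> 2 * V" if "s \<in> S" for s
  proof (cases "s = z")
    case True
    then show ?thesis by (simp add: V_def sum_nonneg)
  next
    case False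
    have "(a s - a z)\<^sup>2 \<le> 2 * ((a s - b)\<^sup>2 + (a z - b)\<^sup>2)"
      using sum_squares_bound[of "a s - b" "b - a z"]
      by (simp add: power2_eq_square algebra_simps)
    also have "(a s - b)\<^sup>2 + (a z - b)\<^sup>2 = (\<Sum>t\<in>{s, z}. (a t - b)\<^sup>2)" using False by simp
    also have "\<dots> \<le> V"
      unfolding V_def using assms that by (intro sum_mono2) auto
    finally show ?thesis by simp
  qed
  then have "(\<Sum>s\<in>S. (a s - a z)\<^sup>2) \<le> N * (2 * V)"
    unfolding N_def using sum_bounded_above[of S "\<lambda>s. (a s - a z)\<^sup>2" "2 * V"] by simp
  then have "(\<Sum>s\<in>S. (a s - a z)\<^sup>2) / (2 * N\<^sup>2) \<le> N * (2 * V) / (2 * N\<^sup>2)"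
    using \<open>N > 0\<close> by (intro divide_right_mono) auto
  also have "\<dots> = V / N" using \<open>N > 0\<close> by (simp add: power2_eq_square)
  also have "\<dots> = (\<Sum>s\<in>S. (a s)\<^sup>2) / N - b\<^sup>2" using \<open>N > 0\<close> by (simp add: V diff_divide_distrib)
  finally show ?thesis by (simp add: b_def)
qed

text \<open>Factor the difference of squares and apply the inequality of arithmetic and geometric
  means with weight \<theta>. A small \<theta> allows the last term to be absorbed later.\<close>

lemma abs_diff_squares_le:
  fixes p q \<theta> :: real
  assumes "\<theta> > 0"
  shows "\<bar>p\<^sup>2 - q\<^sup>2\<bar> \<le> (p - q)\<^sup>2 / (2 * \<theta>) + \<theta> * (p\<^sup>2 + q\<^sup>2)"
proof -
  have "0 \<le> (\<bar>p - q\<bar> - \<theta> * \<bar>p + q\<bar>)\<^sup>2" by simp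
  then have "2 * \<theta> * (\<bar>p - q\<bar> * \<bar>p + q\<bar>) \<le> (p - q)\<^sup>2 + \<theta>\<^sup>2 * (p + q)\<^sup>2"
    by (simp add: power2_diff power_mult_distrib algebra_simps)
  also have "(p + q)\<^sup>2 \<le> 2 * (p\<^sup>2 + q\<^sup>2)"
    using sum_squares_bound[of p q] by (simp add: power2_sum)
  finally have "2 * \<theta> * (\<bar>p - q\<bar> * \<bar>p + q\<bar>) \<le> (p - q)\<^sup>2 + \<theta>\<^sup>2 * (2 * (p\<^sup>2 + q\<^sup>2))"
    by (simp add: mult_left_mono)
  then have "\<bar>p - q\<bar> * \<bar>p + q\<bar> \<le> ((p - q)\<^sup>2 + \<theta>\<^sup>2 * (2 * (p\<^sup>2 + q\<^sup>2))) / (2 * \<theta>)"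
    using assms by (simp add: pos_le_divide_eq mult.commute mult.left_commute)
  also have "\<dots> = (p - q)\<^sup>2 / (2 * \<theta>) + \<theta> * (p\<^sup>2 + q\<^sup>2)"
    using assms by (simp add: field_simps power2_eq_square)
  also have "\<bar>p - q\<bar> * \<bar>p + q\<bar> = \<bar>p\<^sup>2 - q\<^sup>2\<bar>"
    unfolding abs_mult[symmetric] by (simp add: power2_eq_square algebra_simps)
  finally show ?thesis .
qed

text \<open>Each new letter is appended on the right: translating \<open>avg S f\<close> by
  \<open>w\<close> produces translates of \<open>f\<close> by \<open>w + s\<close>, in this order,
  since the group need not be commutative.\<close>

fun sum_words :: "'a::monoid_add set \<Rightarrow> nat \<Rightarrow> 'a set" where
  "sum_words S 0 = {0}"
| "sum_words S (Suc k) = (\<lambda>(w, s). w + s) ` (sum_words S k \<times> S)"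

lemma finite_sum_words: "finite S \<Longrightarrow> finite (sum_words S k)"
  by (induction k) auto

context haar
begin

text \<open>Left convolution with the uniform probability measure on \<open>S\<close>, the Markov
  operator in Kesten's argument.\<close>

definition avg :: "'a set \<Rightarrow> ('a \<Rightarrow> real) \<Rightarrow> 'a \<Rightarrow> real" where
  "avg S f = (\<lambda>x. (\<Sum>s\<in>S. f (- s + x)) / real (card S))"

lemma test_fun_avg: "test_fun f \<Longrightarrow> test_fun (avg S f)"
  using test_fun_scale[OF test_fun_sum[of S "\<lambda>s x. f (- s + x)"], of "1 / real (card S)"]
  by (simp add: avg_def test_fun_translate)

text \<open>The gap hypothesis is applied to \<open>g = f\<^sup>2\<close>.\<close>

lemma avg_contraction:
  assumes S: "finite S" "0 \<in> S" and c: "c > 0"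
    and gap: "\<And>g. \<lbrakk>test_fun g; \<And>x. g x \<ge> 0\<rbrakk> \<Longrightarrow>
      c * (\<integral>x. g x \<partial>m) \<le> (\<Sum>s\<in>S. \<integral>x. \<bar>g (- s + x) - g x\<bar> \<partial>m)"
  obtains r where "0 \<le> r" "r < 1"
    "\<And>f. test_fun f \<Longrightarrow> (\<integral>x. (avg S f x)\<^sup>2 \<partial>m) \<le> r * (\<integral>x. (f x)\<^sup>2 \<partial>m)"
proof -
  define N where "N = real (card S)"
  have N: "N > 0" using S by (auto simp: N_def card_gt_0_iff)
  \<comment> \<open>Chosen so that the terms \<open>\<theta> * (I + I)\<close>, summed over
    \<open>S\<close>, amount to \<open>c / 2 * I\<close>, half of the gap; the other half bounds
    \<open>W\<close> from below.\<close>
  define \<theta> where "\<theta> = c / (4 * N)"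
  have \<theta>: "\<theta> > 0" using c N by (simp add: \<theta>_def)
  \<comment> \<open>The loss is the factor \<open>1 / (2 * N^2)\<close> from
    \<open>average_power2_le\<close> times the factor \<open>c^2 / (4 * N)\<close> in the lower
    bound for \<open>W\<close>.\<close>
  define r where "r = 1 - c\<^sup>2 / (8 * N ^ 3)"
  have main: "(\<integral>x. (avg S f x)\<^sup>2 \<partial>m) \<le> r * (\<integral>x. (f x)\<^sup>2 \<partial>m)" if f: "test_fun f" for f
  proof -
    note intros = test_fun_integrable test_fun_intros f test_fun_avg test_fun_translate[OF f]
    define I where "I = (\<integral>x. (f x)\<^sup>2 \<partial>m)"
    \<comment> \<open>The total squared \<open>L^2\<close> displacement of \<open>f\<close>, which
      the gap forces to be at least a fixed multiple of \<open>I\<close>.\<close>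
    define W where "W = (\<Sum>s\<in>S. \<integral>x. (f (- s + x) - f x)\<^sup>2 \<partial>m)"
    have trans: "(\<integral>x. (f (s + x))\<^sup>2 \<partial>m) = I" for s
      unfolding I_def by (rule integral_translate[where h="\<lambda>x. (f x)\<^sup>2"])
        (intro test_fun_measurable intros)
    have "c * I \<le> (\<Sum>s\<in>S. \<integral>x. \<bar>(f (- s + x))\<^sup>2 - (f x)\<^sup>2\<bar> \<partial>m)"
      unfolding I_def by (rule gap[where g="\<lambda>x. (f x)\<^sup>2"]) (intro intros, simp)
    also have "\<dots> \<le> (\<Sum>s\<in>S. \<integral>x. 1 / (2 * \<theta>) * (f (- s + x) - f x)\<^sup>2
        + \<theta> * ((f (- s + x))\<^sup>2 + (f x)\<^sup>2) \<partial>m)"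
      using abs_diff_squares_le[OF \<theta>] by (intro sum_mono integral_mono intros) simp
    also have "\<dots> = (\<Sum>s\<in>S. 1 / (2 * \<theta>) * (\<integral>x. (f (- s + x) - f x)\<^sup>2 \<partial>m) + \<theta> * (I + I))"
    proof (rule sum.cong)
      fix s
      have "(\<integral>x. 1 / (2 * \<theta>) * (f (- s + x) - f x)\<^sup>2 + \<theta> * ((f (- s + x))\<^sup>2 + (f x)\<^sup>2) \<partial>m)
        = (\<integral>x. 1 / (2 * \<theta>) * (f (- s + x) - f x)\<^sup>2 \<partial>m)
          + (\<integral>x. \<theta> * ((f (- s + x))\<^sup>2 + (f x)\<^sup>2) \<partial>m)"
        by (intro Bochner_Integration.integral_add intros)
      also have "(\<integral>x. \<theta> * ((f (- s + x))\<^sup>2 + (f x)\<^sup>2) \<partial>m)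
          = \<theta> * (\<integral>x. (f (- s + x))\<^sup>2 + (f x)\<^sup>2 \<partial>m)"
        by (rule integral_mult_right_zero)
      also have "(\<integral>x. (f (- s + x))\<^sup>2 + (f x)\<^sup>2 \<partial>m) = (\<integral>x. (f (- s + x))\<^sup>2 \<partial>m) + (\<integral>x. (f x)\<^sup>2 \<partial>m)"
        by (intro Bochner_Integration.integral_add intros)
      finally show "(\<integral>x. 1 / (2 * \<theta>) * (f (- s + x) - f x)\<^sup>2
          + \<theta> * ((f (- s + x))\<^sup>2 + (f x)\<^sup>2) \<partial>m)
        = 1 / (2 * \<theta>) * (\<integral>x. (f (- s + x) - f x)\<^sup>2 \<partial>m) + \<theta> * (I + I)"
        by (simp add: trans I_def)
    qed simp
    also have "\<dots> = W / (2 * \<theta>) + N * (\<theta> * (I + I))"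
      by (simp add: sum.distrib W_def N_def sum_divide_distrib)
    also have "\<dots> = 2 * N / c * W + c / 2 * I"
      using N c by (simp add: \<theta>_def field_simps)
    finally have "2 * N / c * W \<ge> c / 2 * I" by simp
    then have "c / (2 * N) * (c / 2 * I) \<le> c / (2 * N) * (2 * N / c * W)"
      using N c by (intro mult_left_mono) auto
    then have W: "c\<^sup>2 / (4 * N) * I \<le> W"
      using N c by (simp add: power2_eq_square mult_ac)
    have "(\<integral>x. (avg S f x)\<^sup>2 \<partial>m) \<le> (\<integral>x. 1 / N * (\<Sum>s\<in>S. (f (- s + x))\<^sup>2)
        - 1 / (2 * N\<^sup>2) * (\<Sum>s\<in>S. (f (- s + x) - f x)\<^sup>2) \<partial>m)"
      using average_power2_le[OF S, of "\<lambda>s. f (- s + _)"]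
      by (intro integral_mono intros) (simp add: avg_def N_def)
    also have "\<dots> = (\<integral>x. 1 / N * (\<Sum>s\<in>S. (f (- s + x))\<^sup>2) \<partial>m)
        - (\<integral>x. 1 / (2 * N\<^sup>2) * (\<Sum>s\<in>S. (f (- s + x) - f x)\<^sup>2) \<partial>m)"
      by (intro Bochner_Integration.integral_diff intros)
    also have "(\<integral>x. 1 / N * (\<Sum>s\<in>S. (f (- s + x))\<^sup>2) \<partial>m) = 1 / N * (\<Sum>s\<in>S. I)"
      unfolding integral_mult_right_zero
      by (subst Bochner_Integration.integral_sum) (auto intro!: intros simp: trans)
    also have "\<dots> = I" using N by (simp add: N_def)
    also have "(\<integral>x. 1 / (2 * N\<^sup>2) * (\<Sum>s\<in>S. (f (- s + x) - f x)\<^sup>2) \<partial>m) = 1 / (2 * N\<^sup>2) * W"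
      unfolding integral_mult_right_zero W_def
      by (subst Bochner_Integration.integral_sum) (auto intro!: intros)
    also have "I - 1 / (2 * N\<^sup>2) * W \<le> I - 1 / (2 * N\<^sup>2) * (c\<^sup>2 / (4 * N) * I)"
      using W N by (intro diff_left_mono mult_left_mono) auto
    also have "\<dots> = r * I" using N by (simp add: r_def field_simps power2_eq_square power3_eq_cube)
    finally show ?thesis by (simp add: I_def)
  qed
  show thesis
  \<comment> \<open>Nothing so far excludes a negative \<open>r\<close>, whereas the iteration of
    the contraction multiplies inequalities by it.\<close>
  proof (rule that[of "max r 0"])
    show "max r 0 < 1" using c N by (simp add: r_def)
    fix f assume f: "test_fun f"
    have "(\<integral>x. (avg S f x)\<^sup>2 \<partial>m) \<le> r * (\<integral>x. (f x)\<^sup>2 \<partial>m)" by (rule main[OF f])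
    also have "\<dots> \<le> max r 0 * (\<integral>x. (f x)\<^sup>2 \<partial>m)" by (intro mult_right_mono) auto
    finally show "(\<integral>x. (avg S f x)\<^sup>2 \<partial>m) \<le> max r 0 * (\<integral>x. (f x)\<^sup>2 \<partial>m)" .
  qed simp
qed

section \<open>Iterated averages and their correlation with a fixed function\<close>

lemma test_fun_avg_funpow: "test_fun f \<Longrightarrow> test_fun ((avg S ^^ k) f)"
  by (induction k) (auto intro: test_fun_avg)

text \<open>The \<open>k\<close>-fold average of \<open>f\<close> is an average, with
  multiplicities, of its translates by words of length \<open>k\<close>, and an average of numbers
  at least \<open>d\<close> is at least \<open>d\<close>. The induction generalises \<open>f\<close>
  and peels off the innermost average, so the hypothesis for \<open>avg S f\<close> and
  \<open>k\<close> follows from that for \<open>f\<close> and \<open>Suc k\<close>.\<close>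

lemma avg_funpow_correlation_ge:
  assumes S: "finite S" "S \<noteq> {}" and h: "test_fun h"
  shows "\<lbrakk>test_fun f; \<And>w. w \<in> sum_words S k \<Longrightarrow> d \<le> (\<integral>x. f (- w + x) * h x \<partial>m)\<rbrakk> \<Longrightarrow>
    d \<le> (\<integral>x. (avg S ^^ k) f x * h x \<partial>m)"
proof (induction k arbitrary: f)
  case 0
  then show ?case by simp
next
  case (Suc k)
  have "d \<le> (\<integral>x. avg S f (- w + x) * h x \<partial>m)" if w: "w \<in> sum_words S k" for w
  proof -
    have shift: "- s + (- w + x) = - (w + s) + x" for s x
      by (simp add: minus_add add.assoc del: add_uminus_conv_diff)
    have "(\<integral>x. avg S f (- w + x) * h x \<partial>m)
        = (\<integral>x. 1 / real (card S) * (\<Sum>s\<in>S. f (- (w + s) + x) * h x) \<partial>m)"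
      by (simp add: avg_def sum_distrib_right shift)
    also have "\<dots> = 1 / real (card S) * (\<Sum>s\<in>S. \<integral>x. f (- (w + s) + x) * h x \<partial>m)"
      unfolding integral_mult_right_zero
      by (subst Bochner_Integration.integral_sum)
        (auto intro!: test_fun_integrable test_fun_times h test_fun_translate[OF Suc.prems(1)])
    also have "\<dots> \<ge> 1 / real (card S) * (\<Sum>s\<in>S. d)"
      using w by (intro mult_left_mono sum_mono Suc.prems(2)) auto
    also have "1 / real (card S) * (\<Sum>s\<in>S. d) = d" using S by simp
    finally show ?thesis .
  qed
  from Suc.IH[OF test_fun_avg[OF Suc.prems(1)] this] show ?case
    by (simp add: funpow_Suc_right del: funpow.simps)
qed

text \<open>
  Reiter's condition for finite sets. Since sums of absolute values are nonnegative, the strict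
  inequality forces \<open>g\<close> to have positive integral.
\<close>

definition reiter_condition :: bool where
  "reiter_condition \<longleftrightarrow> (\<forall>S c. finite S \<and> c > 0 \<longrightarrow>
     (\<exists>g. test_fun g \<and> (\<forall>x. g x \<ge> 0) \<and>
       (\<Sum>s\<in>S. \<integral>x. \<bar>g (- s + x) - g x\<bar> \<partial>m) < c * (\<integral>x. g x \<partial>m)))"

text \<open>Under a spectral gap, the \<open>k\<close>-fold average of the indicator of
  \<open>C\<close> has small \<open>L^2\<close> norm relative to \<open>C\<close>, hence small
  correlation with any \<open>n\<close> translates of \<open>C\<close>. If every word of length
  \<open>k\<close> moves \<open>C\<close> onto a substantial part of one of these translates, the
  same correlation stays large.\<close>

lemma overlap_imp_reiter:
  assumes n: "n \<ge> 1" and \<delta>: "\<delta> > 0"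
    and overlap: "\<And>F. finite F \<Longrightarrow> \<exists>C E. compact C \<and> measure m C > 0 \<and> finite E \<and> card E \<le> n \<and>
       (\<forall>s\<in>F. \<exists>t\<in>E. measure m ((+) s ` C \<inter> (+) t ` C) \<ge> \<delta> * measure m C)"
  shows reiter_condition
proof (rule ccontr)
  assume "\<not> reiter_condition"
  then obtain S0 c where S0: "finite S0" and c: "c > 0"
    and gap0: "\<And>g. \<lbrakk>test_fun g; \<And>x. g x \<ge> 0\<rbrakk> \<Longrightarrow>
      c * (\<integral>x. g x \<partial>m) \<le> (\<Sum>s\<in>S0. \<integral>x. \<bar>g (- s + x) - g x\<bar> \<partial>m)"
    unfolding reiter_condition_def not_all not_imp not_ex de_Morgan_conj not_less by blast
  \<comment> \<open>Adding 0 only enlarges the right-hand side of the gap and supplies the base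
    point \<open>z = 0\<close> for comparing \<open>f (- s + x)\<close> with
    \<open>f x\<close>.\<close>
  define S where "S = insert 0 S0"
  have S: "finite S" "0 \<in> S" using S0 by (auto simp: S_def)
  have gap: "c * (\<integral>x. g x \<partial>m) \<le> (\<Sum>s\<in>S. \<integral>x. \<bar>g (- s + x) - g x\<bar> \<partial>m)"
    if "test_fun g" "\<And>x. g x \<ge> 0" for g
  proof -
    note gap0[OF that]
    also have "(\<Sum>s\<in>S0. \<integral>x. \<bar>g (- s + x) - g x\<bar> \<partial>m) \<le> (\<Sum>s\<in>S. \<integral>x. \<bar>g (- s + x) - g x\<bar> \<partial>m)"
      using S0 by (intro sum_mono2) (auto simp: S_def)
    finally show ?thesis .
  qed
  obtain r where r: "0 \<le> r" "r < 1"
    and contr: "\<And>f. test_fun f \<Longrightarrow> (\<integral>x. (avg S f x)\<^sup>2 \<partial>m) \<le> r * (\<integral>x. (f x)\<^sup>2 \<partial>m)"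
    using avg_contraction[OF S c gap] by blast
  \<comment> \<open>Each of the at most \<open>n\<close> translates may contribute \<eta> times the
    measure of \<open>C\<close>, in total at most half of what the overlaps require.\<close>
  define \<eta> where "\<eta> = \<delta> / (2 * real n)"
  have \<eta>: "\<eta> > 0" using \<delta> n by (simp add: \<eta>_def)
  have "\<exists>k. r ^ k < \<eta>\<^sup>2" using r \<eta> by (intro real_arch_pow_inv) auto
  \<comment> \<open>The length \<open>k\<close> depends on \<open>r\<close>, \<delta> and
    \<open>n\<close> only. It is therefore fixed before \<open>C\<close> and \<open>E\<close>, which
    depend on the set of words of length \<open>k\<close>.\<close>
  then obtain k where k: "r ^ k < \<eta>\<^sup>2" by blast
  obtain C E where C: "compact C" "measure m C > 0" and E: "finite E" "card E \<le> n"
    and ov: "\<And>s. s \<in> sum_words S k \<Longrightarrow>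
      \<exists>t\<in>E. measure m ((+) s ` C \<inter> (+) t ` C) \<ge> \<delta> * measure m C"
    using overlap[OF finite_sum_words[OF S(1), of k]] by blast
  define f :: "'a \<Rightarrow> real" where "f = indicator C"
  have f: "test_fun f" unfolding f_def by (intro test_fun_indicator compact_fmeasurable C)
  \<comment> \<open>One function dominating the indicators of all \<open>t + C\<close>, so that the
    choice of \<open>t\<close> may vary with the word.\<close>
  define h where "h = (\<lambda>x. \<Sum>t\<in>E. f (- t + x))"
  note intros = test_fun_integrable test_fun_intros f test_fun_avg_funpow test_fun_translate[OF f]
  have h: "test_fun h" unfolding h_def by (intro intros)
  have f_shift: "f (- s + x) = indicator ((+) s ` C) x" for s x
    by (simp add: f_def image_add_eq_vimage indicator_def)
  have int_f: "(\<integral>x. (f x)\<^sup>2 \<partial>m) = measure m C"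
    by (simp add: f_def power2_eq_square indicator_inter_arith[symmetric])
  have low: "\<delta> * measure m C \<le> (\<integral>x. f (- w + x) * h x \<partial>m)" if "w \<in> sum_words S k" for w
  proof -
    obtain t where t: "t \<in> E" "\<delta> * measure m C \<le> measure m ((+) w ` C \<inter> (+) t ` C)"
      using ov \<open>w \<in> sum_words S k\<close> by blast
    note t(2)
    also have "measure m ((+) w ` C \<inter> (+) t ` C) = (\<integral>x. f (- w + x) * f (- t + x) \<partial>m)"
      by (simp add: f_shift indicator_inter_arith[symmetric])
    also have "\<dots> \<le> (\<integral>x. f (- w + x) * h x \<partial>m)"
    proof (intro integral_mono test_fun_times intros h)
      fix x
      have "f (- t + x) \<le> h x"
        unfolding h_def using E t by (intro member_le_sum) (auto simp: f_def)
      then show "f (- w + x) * f (- t + x) \<le> f (- w + x) * h x"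
        by (intro mult_left_mono) (auto simp: f_def)
    qed
    finally show ?thesis .
  qed
  define g where "g = (avg S ^^ k) f"
  have g: "test_fun g" unfolding g_def by (intro intros)
  have "(\<integral>x. ((avg S ^^ j) f x)\<^sup>2 \<partial>m) \<le> r ^ j * measure m C" for j
  proof (induction j)
    case (Suc j)
    have "(\<integral>x. ((avg S ^^ Suc j) f x)\<^sup>2 \<partial>m) \<le> r * (\<integral>x. ((avg S ^^ j) f x)\<^sup>2 \<partial>m)"
      using contr[OF test_fun_avg_funpow[OF f]] by simp
    also have "\<dots> \<le> r * (r ^ j * measure m C)" by (intro mult_left_mono Suc r)
    finally show ?case by simp
  qed (simp add: int_f)
  then have "(\<integral>x. (g x)\<^sup>2 \<partial>m) \<le> r ^ k * measure m C" by (simp add: g_def)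
  also have "\<dots> < \<eta>\<^sup>2 * measure m C" using k C by simp
  finally have g2: "(\<integral>x. (g x)\<^sup>2 \<partial>m) < \<eta>\<^sup>2 * measure m C" .
  \<comment> \<open>Cauchy-Schwarz in the form of a weighted arithmetic-geometric mean inequality;
    with weight \<eta> both terms are at most \<open>\<eta> / 2 * measure m C\<close>, the first
    strictly.\<close>
  have up: "(\<integral>x. g x * f (- t + x) \<partial>m) < \<eta> * measure m C" for t
  proof -
    have gf: "test_fun (\<lambda>x. g x * f (- t + x))" by (intro test_fun_times intros g)
    have "(\<integral>x. g x * f (- t + x) \<partial>m) \<le> (\<integral>x. 1 / (2 * \<eta>) * (g x)\<^sup>2 + \<eta> / 2 * (f (- t + x))\<^sup>2 \<partial>m)"
    proof (intro integral_mono intros gf g)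
      fix x
      have "0 \<le> (g x - \<eta> * f (- t + x))\<^sup>2" by simp
      then show "g x * f (- t + x) \<le> 1 / (2 * \<eta>) * (g x)\<^sup>2 + \<eta> / 2 * (f (- t + x))\<^sup>2"
        using \<eta> by (simp add: field_simps power2_eq_square)
    qed
    also have "\<dots> = 1 / (2 * \<eta>) * (\<integral>x. (g x)\<^sup>2 \<partial>m) + \<eta> / 2 * (\<integral>x. (f (- t + x))\<^sup>2 \<partial>m)"
      unfolding integral_mult_right_zero[symmetric]
      by (intro Bochner_Integration.integral_add intros g)
    also have "(\<integral>x. (f (- t + x))\<^sup>2 \<partial>m) = measure m C"
      using integral_translate[of "\<lambda>x. (f x)\<^sup>2" "- t"] test_fun_power2[OF f, THEN test_fun_measurable]
      by (simp add: int_f)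
    also have "1 / (2 * \<eta>) * (\<integral>x. (g x)\<^sup>2 \<partial>m) < 1 / (2 * \<eta>) * (\<eta>\<^sup>2 * measure m C)"
      using g2 \<eta> by (intro mult_strict_left_mono) auto
    also have "1 / (2 * \<eta>) * (\<eta>\<^sup>2 * measure m C) + \<eta> / 2 * measure m C = \<eta> * measure m C"
      using \<eta> by (simp add: field_simps power2_eq_square)
    finally show ?thesis by simp
  qed
  have "\<delta> * measure m C \<le> (\<integral>x. g x * h x \<partial>m)"
    unfolding g_def using S by (intro avg_funpow_correlation_ge low f h) auto
  also have "\<dots> = (\<Sum>t\<in>E. \<integral>x. g x * f (- t + x) \<partial>m)"
    unfolding h_def sum_distrib_left
    by (intro Bochner_Integration.integral_sum test_fun_times intros g)
  also have "\<dots> \<le> (\<Sum>t\<in>E. \<eta> * measure m C)"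
    by (intro sum_mono less_imp_le up)
  also have "\<dots> \<le> real n * (\<eta> * measure m C)"
    using E C \<eta> by (simp add: mult_right_mono)
  also have "\<dots> = \<delta> / 2 * measure m C" using n by (simp add: \<eta>_def)
  finally show False using C \<delta> by simp
qed

end

section \<open>Invariant means from almost invariant densities\<close>

text \<open>A Bonferroni inequality: adding a set to \<open>j\<close> earlier ones loses at most
  \<open>j * d\<close>, and the sum of \<open>0, ..., j - 1\<close> is at most
  \<open>j^2 / 2\<close>.\<close>

lemma measure_UN_ge:
  assumes "finite E" "d \<ge> 0" and A: "\<And>s. s \<in> E \<Longrightarrow> A s \<in> fmeasurable M \<and> measure M (A s) = \<mu>"
    and "\<And>s t. \<lbrakk>s \<in> E; t \<in> E; s \<noteq> t\<rbrakk> \<Longrightarrow> measure M (A s \<inter> A t) \<le> d"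
  shows "real (card E) * \<mu> - (real (card E))\<^sup>2 * d / 2 \<le> measure M (\<Union>s\<in>E. A s)"
  using assms
proof (induction E)
  case empty
  then show ?case by simp
next
  case (insert s E)
  let ?U = "\<Union>t\<in>E. A t"
  have U: "?U \<in> fmeasurable M" using insert by (intro fmeasurable.finite_UN) auto
  have "?U \<inter> A s = (\<Union>t\<in>E. A t \<inter> A s)" by auto
  then have "measure M (?U \<inter> A s) = measure M (\<Union>t\<in>E. A t \<inter> A s)" by (rule arg_cong)
  also have "\<dots> \<le> (\<Sum>t\<in>E. measure M (A t \<inter> A s))"
    using insert by (intro measure_UNION_le sets.Int fmeasurableD) auto
  also have "\<dots> \<le> (\<Sum>t\<in>E. d)" using insert by (intro sum_mono insert.prems) auto
  finally have "measure M (?U \<inter> A s) \<le> real (card E) * d" by simp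
  moreover have "real (card E) * \<mu> - (real (card E))\<^sup>2 * d / 2 \<le> measure M ?U"
    using insert by auto
  moreover have "measure M (?U \<union> A s) = measure M ?U + measure M (A s) - measure M (?U \<inter> A s)"
    using U insert.prems by (intro measure_Un3) auto
  ultimately have "real (card E) * \<mu> - (real (card E))\<^sup>2 * d / 2 + \<mu> - real (card E) * d
      \<le> measure M (\<Union>t\<in>insert s E. A t)"
    using insert.prems(2)[of s] by (simp add: Un_commute)
  moreover have "real (card (insert s E)) * \<mu> - (real (card (insert s E)))\<^sup>2 * d / 2
      = real (card E) * \<mu> - (real (card E))\<^sup>2 * d / 2 + \<mu> - real (card E) * d - d / 2"
    using insert by (simp add: power2_eq_square field_simps)
  ultimately show ?case using \<open>d \<ge> 0\<close> by linarith
qed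

section \<open>Closed and compact sets of functionals in the product topology\<close>

lemma closed_Collect_Ball: "(\<And>a. a \<in> A \<Longrightarrow> closed {x. P a x}) \<Longrightarrow> closed {x. \<forall>a\<in>A. P a x}"
  using closed_INT[of A "\<lambda>a. {x. P a x}"] by (simp add: Collect_ball_eq)

lemma closed_Collect_imp_const: "(P \<Longrightarrow> closed {x. Q x}) \<Longrightarrow> closed {x. P \<longrightarrow> Q x}"
  by (cases P) auto

text \<open>Tychonoff's theorem for function spaces.\<close>

lemma compact_PiE_UNIV:
  fixes A :: "'i \<Rightarrow> 'b::topological_space set"
  shows "(\<And>i. compact (A i)) \<Longrightarrow> compact (PiE UNIV A)"
  using compactin_PiE[of "\<lambda>_. euclidean" UNIV A] by (simp add: euclidean_product_topology)

text \<open>Each clause in the definition of a mean is a closed condition on finitely many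
  coordinates \<open>\<Lambda> \<phi>\<close>, hence survives pointwise limits.\<close>

lemma closed_mean_on_L_infinity: "closed {\<Lambda>. mean_on_L_infinity m \<Lambda>}"
proof -
  have "closed {\<Lambda> :: ('a \<Rightarrow> complex) \<Rightarrow> complex. \<Lambda> \<phi> \<in> \<real>\<^sub>\<ge>\<^sub>0}" for \<phi>
    using closed_vimage[OF closed_nonneg_Reals_complex continuous_on_product_coordinates]
    by (simp add: vimage_def)
  moreover have "closed {\<Lambda> :: ('a \<Rightarrow> complex) \<Rightarrow> complex. \<Lambda> \<phi> = \<Lambda> \<psi>}"
    "closed {\<Lambda> :: ('a \<Rightarrow> complex) \<Rightarrow> complex. \<Lambda> \<phi> = a}"
    "closed {\<Lambda> :: ('a \<Rightarrow> complex) \<Rightarrow> complex. \<Lambda> \<phi> = \<Lambda> \<psi> + \<Lambda> \<rho>}"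
    "closed {\<Lambda> :: ('a \<Rightarrow> complex) \<Rightarrow> complex. \<Lambda> \<phi> = a * \<Lambda> \<psi>}" for \<phi> \<psi> \<rho> a
    by (rule closed_Collect_eq; intro continuous_on_add continuous_on_mult continuous_on_const
        continuous_on_product_coordinates)+
  ultimately show ?thesis
    unfolding mean_on_L_infinity_def linear_functional_on_L_infinity_def
    by (intro closed_Collect_conj closed_Collect_Ball closed_Collect_imp_const closed_Collect_all)
qed

section \<open>Locally essentially bounded functions\<close>

lemma locally_AE_conj:
  assumes "locally_AE M P" "locally_AE M Q" "\<And>x. P x \<Longrightarrow> Q x \<Longrightarrow> R x"
  shows "locally_AE M R"
  unfolding locally_AE_def
proof (intro ballI impI)
  fix A assume "A \<in> sets M" "emeasure M A < \<infinity>"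
  then have "AE x\<in>A in M. P x" "AE x\<in>A in M. Q x"
    using assms(1,2) by (auto simp: locally_AE_def)
  then show "AE x\<in>A in M. R x" by eventually_elim (use assms(3) in auto)
qed

lemma locally_AE_mono: "locally_AE M P \<Longrightarrow> (\<And>x. P x \<Longrightarrow> R x) \<Longrightarrow> locally_AE M R"
  by (rule locally_AE_conj)

lemma L_infinity_add:
  assumes "\<phi> \<in> L_infinity M" "\<psi> \<in> L_infinity M"
  shows "(\<lambda>x. \<phi> x + \<psi> x) \<in> L_infinity M"
proof -
  obtain c d where c: "locally_AE M (\<lambda>x. norm (\<phi> x) \<le> c)" and d: "locally_AE M (\<lambda>x. norm (\<psi> x) \<le> d)"
    using assms by (auto simp: L_infinity_def)
  have "locally_AE M (\<lambda>x. norm (\<phi> x + \<psi> x) \<le> c + d)"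
    by (rule locally_AE_conj[OF c d]) (rule norm_triangle_mono)
  moreover have "locally_measurable M (\<lambda>x. \<phi> x + \<psi> x)"
    using assms by (auto simp: L_infinity_def locally_measurable_def intro!: borel_measurable_add)
  ultimately show ?thesis by (auto simp: L_infinity_def)
qed

lemma L_infinity_scale:
  assumes "\<phi> \<in> L_infinity M" shows "(\<lambda>x. a * \<phi> x) \<in> L_infinity M"
proof -
  obtain c where c: "locally_AE M (\<lambda>x. norm (\<phi> x) \<le> c)"
    using assms by (auto simp: L_infinity_def)
  have "locally_AE M (\<lambda>x. norm (a * \<phi> x) \<le> norm a * c)"
    by (rule locally_AE_mono[OF c]) (simp add: norm_mult mult_left_mono)
  moreover have "locally_measurable M (\<lambda>x. a * \<phi> x)"
    using assms by (auto simp: L_infinity_def locally_measurable_def intro!: borel_measurable_times)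
  ultimately show ?thesis by (auto simp: L_infinity_def)
qed

lemma L_infinity_const: "(\<lambda>x. a) \<in> L_infinity M"
  by (auto simp: L_infinity_def locally_measurable_def locally_AE_def)

text \<open>The radius of the disc for the coordinate \<phi> in the Tychonoff product. The default 0
  pins the coordinates outside \<open>L_infinity M\<close> to the value 0.\<close>

definition essential_bound :: "'a measure \<Rightarrow> ('a \<Rightarrow> complex) \<Rightarrow> real" where
  "essential_bound M \<phi> =
    (if \<phi> \<in> L_infinity M then SOME c. c \<ge> 0 \<and> locally_AE M (\<lambda>x. norm (\<phi> x) \<le> c) else 0)"

lemma essential_bound:
  assumes "\<phi> \<in> L_infinity M"
  shows "essential_bound M \<phi> \<ge> 0" "locally_AE M (\<lambda>x. norm (\<phi> x) \<le> essential_bound M \<phi>)"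
proof -
  obtain c where c: "locally_AE M (\<lambda>x. norm (\<phi> x) \<le> c)"
    using assms by (auto simp: L_infinity_def)
  have "locally_AE M (\<lambda>x. norm (\<phi> x) \<le> max c 0)"
    by (rule locally_AE_mono[OF c]) auto
  then have "\<exists>c. c \<ge> 0 \<and> locally_AE M (\<lambda>x. norm (\<phi> x) \<le> c)"
    by (intro exI[of _ "max c 0"]) auto
  from someI_ex[OF this] show "essential_bound M \<phi> \<ge> 0"
    "locally_AE M (\<lambda>x. norm (\<phi> x) \<le> essential_bound M \<phi>)"
    using assms by (auto simp: essential_bound_def)
qed

context haar
begin

text \<open>Take a maximal subset of \<open>F\<close> whose translates of \<open>C\<close> overlap
  pairwise in less than the fraction \<open>1 / n\<close>. By Bonferroni \<open>n\<close> such
  translates would cover at least half of their total measure, against the assumption; by maximality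
  every other translate overlaps a chosen one.\<close>

lemma small_unions_imp_overlap:
  assumes n: "n \<ge> 1" and F: "finite F" and C: "compact C"
    and small: "\<And>E. \<lbrakk>E \<subseteq> F; card E \<ge> n\<rbrakk> \<Longrightarrow> measure m (E + C) < 1 / 2 * real (card E) * measure m C"
  shows "\<exists>C E. compact C \<and> measure m C > 0 \<and> finite E \<and> card E \<le> n \<and>
       (\<forall>s\<in>F. \<exists>t\<in>E. measure m ((+) s ` C \<inter> (+) t ` C) \<ge> 1 / real n * measure m C)"
proof (cases "card F < n")
  case True
  \<comment> \<open>Without \<open>n\<close> elements in \<open>F\<close> nothing ensures that
    \<open>C\<close> has positive measure. Another compact set is taken, with \<open>F\<close>
    itself as \<open>E\<close>: each translate overlaps itself in full.\<close>
  obtain K where K: "compact K" "measure m K > 0" using exists_compact_pos by blast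
  have "measure m K / real n \<le> measure m K"
    using n K divide_left_mono[of 1 "real n" "measure m K"] by simp
  then have "measure m ((+) s ` K \<inter> (+) s ` K) \<ge> 1 / real n * measure m K" for s
    using K by (simp add: measure_translate compact_borel)
  then have "\<forall>s\<in>F. \<exists>t\<in>F. measure m ((+) s ` K \<inter> (+) t ` K) \<ge> 1 / real n * measure m K"
    by blast
  moreover have "card F \<le> n" using True by simp
  ultimately show ?thesis using K F by - (rule exI[of _ K], rule exI[of _ F], simp)
next
  case False
  \<comment> \<open>The strict inequality for \<open>E = F\<close> forces \<open>C\<close> to have
    positive measure.\<close>
  have "0 \<le> measure m (F + C)" by simp
  also have "\<dots> < 1 / 2 * real (card F) * measure m C" using False by (intro small) auto
  finally have pos: "measure m C > 0" by (simp add: zero_less_mult_iff)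
  define sep where "sep E \<longleftrightarrow> (\<forall>s\<in>E. \<forall>t\<in>E. s \<noteq> t \<longrightarrow>
    measure m ((+) s ` C \<inter> (+) t ` C) < 1 / real n * measure m C)" for E
  have "{} \<in> {E. E \<subseteq> F \<and> sep E}" by (simp add: sep_def)
  moreover have "finite {E. E \<subseteq> F \<and> sep E}"
    by (rule finite_subset[of _ "Pow F"]) (use F in auto)
  ultimately obtain E where E: "E \<subseteq> F" "sep E" and max: "\<And>E'. E' \<subseteq> F \<Longrightarrow> sep E' \<Longrightarrow> E \<subseteq> E' \<Longrightarrow> E = E'"
    using finite_has_maximal[of "{E. E \<subseteq> F \<and> sep E}"]
    by (metis (no_types, lifting) empty_iff mem_Collect_eq)
  have finE: "finite E" using E(1) F by (rule finite_subset)
  have "card E \<le> n"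
  proof (rule ccontr)
    assume "\<not> card E \<le> n"
    then have "n \<le> card E" by simp
    \<comment> \<open>The Bonferroni bound for \<open>j\<close> translates reaches half of their
      total measure only for \<open>j \<le> n\<close>, so a subset of exactly \<open>n\<close>
      elements is used.\<close>
    then obtain E' where E': "E' \<subseteq> E" "card E' = n" "finite E'"
      by (rule obtain_subset_with_card_n)
    have "real (card E') * measure m C - (real (card E'))\<^sup>2 * (1 / real n * measure m C) / 2
        \<le> measure m (\<Union>s\<in>E'. (+) s ` C)"
    proof (rule measure_UN_ge)
      show "measure m ((+) s ` C \<inter> (+) t ` C) \<le> 1 / real n * measure m C"
        if "s \<in> E'" "t \<in> E'" "s \<noteq> t" for s t
      proof (rule less_imp_le)
        show "measure m ((+) s ` C \<inter> (+) t ` C) < 1 / real n * measure m C"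
          using E(2) E'(1) that unfolding sep_def by blast
      qed
    qed (use E' pos C in \<open>auto simp: measure_translate compact_borel
        intro!: compact_fmeasurable compact_translate\<close>)
    moreover have "measure m (E' + C) < 1 / 2 * real (card E') * measure m C"
      using E' E by (intro small) auto
    ultimately show False
      using n by (simp add: set_plus_eq_UN E' power2_eq_square)
  qed
  moreover have "\<exists>t\<in>E. measure m ((+) s ` C \<inter> (+) t ` C) \<ge> 1 / real n * measure m C"
    if s: "s \<in> F" for s
  proof (cases "s \<in> E")
    case True
    have "measure m C / real n \<le> measure m C"
      using n pos divide_left_mono[of 1 "real n" "measure m C"] by simp
    then show ?thesis
      using True C by (intro bexI[of _ s]) (auto simp: measure_translate compact_borel)
  next
    case False
    then have "\<not> sep (insert s E)" using max[of "insert s E"] s E by blast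
    then obtain a b where ab: "a \<in> insert s E" "b \<in> insert s E" "a \<noteq> b"
      and ov: "\<not> measure m ((+) a ` C \<inter> (+) b ` C) < 1 / real n * measure m C"
      unfolding sep_def by blast
    have "\<not> (a \<in> E \<and> b \<in> E)" using E(2) ab(3) ov unfolding sep_def by blast
    then consider "a = s" "b \<in> E" | "b = s" "a \<in> E" using ab by blast
    then show ?thesis
    proof cases
      case 1
      then show ?thesis using ov by (intro bexI[of _ b]) (auto simp: not_less)
    next
      case 2
      then show ?thesis using ov by (intro bexI[of _ a]) (auto simp: not_less Int_commute)
    qed
  qed
  ultimately show ?thesis using C pos finE by blast
qed

section \<open>Translates of bounded functions and integration against densities\<close>

lemma locally_AE_translate:
  assumes "locally_AE m P" shows "locally_AE m (\<lambda>x. P (s + x))"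
  unfolding locally_AE_def
proof (intro ballI impI)
  fix A assume A: "A \<in> sets m" "emeasure m A < \<infinity>"
  have "(+) s ` A \<in> sets m" "emeasure m ((+) s ` A) < \<infinity>"
    using A by (auto simp: translate_borel emeasure_translate)
  then have "AE y in distr m m ((+) s). y \<in> (+) s ` A \<longrightarrow> P y"
    unfolding distr_translate using assms by (simp add: locally_AE_def)
  then have "AE x in m. s + x \<in> (+) s ` A \<longrightarrow> P (s + x)"
    by (intro AE_distrD[of "(+) s" m m]) auto
  then show "AE x\<in>A in m. P (s + x)" by auto
qed

text \<open>Cutting off by an indicator gives a function on the whole group, which can be composed
  with a translation.\<close>

lemma locally_measurable_iff:
  "locally_measurable m \<phi> \<longleftrightarrow> (\<forall>A\<in>sets m. emeasure m A < \<infinity> \<longrightarrow>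
     (\<lambda>x. indicator A x *\<^sub>R \<phi> x) \<in> borel_measurable m)"
  unfolding locally_measurable_def
  by (intro ball_cong refl imp_cong) (auto simp: borel_measurable_restrict_space_iff)

lemma L_infinity_translate:
  assumes "\<phi> \<in> L_infinity m" shows "(\<lambda>x. \<phi> (s + x)) \<in> L_infinity m"
proof -
  obtain c where "locally_AE m (\<lambda>x. norm (\<phi> x) \<le> c)"
    using assms by (auto simp: L_infinity_def)
  then have "locally_AE m (\<lambda>x. norm (\<phi> (s + x)) \<le> c)" by (rule locally_AE_translate)
  moreover have "locally_measurable m (\<lambda>x. \<phi> (s + x))"
    unfolding locally_measurable_iff
  proof (intro ballI impI)
    fix A assume A: "A \<in> sets m" "emeasure m A < \<infinity>"
    then have "(+) s ` A \<in> sets m" "emeasure m ((+) s ` A) < \<infinity>"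
      by (auto simp: translate_borel emeasure_translate)
    then have [measurable]: "(\<lambda>x. indicator ((+) s ` A) x *\<^sub>R \<phi> x) \<in> borel_measurable m"
      using assms by (auto simp: L_infinity_def locally_measurable_iff)
    have "(\<lambda>x. indicator ((+) s ` A) (s + x) *\<^sub>R \<phi> (s + x)) \<in> borel_measurable m"
      by measurable
    then show "(\<lambda>x. indicator A x *\<^sub>R \<phi> (s + x)) \<in> borel_measurable m"
      by (simp add: indicator_def image_iff)
  qed
  ultimately show ?thesis by (auto simp: L_infinity_def)
qed

text \<open>The function \<open>g\<close> lives on a set of finite measure, where \<phi> is
  measurable and its local bound holds almost everywhere.\<close>

lemma
  assumes g: "test_fun g" and \<phi>: "\<phi> \<in> L_infinity m"
  shows integrable_test_fun_L_infinity: "integrable m (\<lambda>x. g x *\<^sub>R \<phi> x)"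
    and norm_integral_test_fun_le:
      "locally_AE m (\<lambda>x. norm (\<phi> x) \<le> c) \<Longrightarrow> norm (\<integral>x. g x *\<^sub>R \<phi> x \<partial>m) \<le> c * (\<integral>x. \<bar>g x\<bar> \<partial>m)"
proof -
  obtain A B where A: "g \<in> borel_measurable m" "\<And>x. \<bar>g x\<bar> \<le> B" "B \<ge> 0"
    "A \<in> sets m" "emeasure m A < \<infinity>" "\<And>x. x \<notin> A \<Longrightarrow> g x = 0"
    using g by (rule test_funE) blast
  have "(\<lambda>x. indicator A x *\<^sub>R \<phi> x) \<in> borel_measurable m"
    using \<phi> A by (auto simp: L_infinity_def locally_measurable_iff)
  then have "(\<lambda>x. g x *\<^sub>R (indicator A x *\<^sub>R \<phi> x)) \<in> borel_measurable m"
    using A(1) by measurable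
  also have "(\<lambda>x. g x *\<^sub>R (indicator A x *\<^sub>R \<phi> x)) = (\<lambda>x. g x *\<^sub>R \<phi> x)"
    using A(6) by (auto simp: fun_eq_iff indicator_def)
  finally have meas: "(\<lambda>x. g x *\<^sub>R \<phi> x) \<in> borel_measurable m" .
  have AE: "AE x in m. norm (g x *\<^sub>R \<phi> x) \<le> c * \<bar>g x\<bar>" if "locally_AE m (\<lambda>x. norm (\<phi> x) \<le> c)" for c
  proof -
    have "AE x\<in>A in m. norm (\<phi> x) \<le> c" using that A by (auto simp: locally_AE_def)
    then show ?thesis
    proof eventually_elim
      case (elim x)
      then show ?case using A(6)[of x]
        by (cases "x \<in> A") (auto simp: mult.commute[of c] mult_left_mono)
    qed
  qed
  have int: "integrable m (\<lambda>x. c * \<bar>g x\<bar>)" for c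
    by (intro test_fun_integrable test_fun_intros g)
  obtain d where d: "locally_AE m (\<lambda>x. norm (\<phi> x) \<le> d)" using \<phi> by (auto simp: L_infinity_def)
  show intg: "integrable m (\<lambda>x. g x *\<^sub>R \<phi> x)"
    using AE[OF d] by (intro Bochner_Integration.integrable_bound[OF int[of d] meas]) (auto elim!: AE_mp)
  assume c: "locally_AE m (\<lambda>x. norm (\<phi> x) \<le> c)"
  have "norm (\<integral>x. g x *\<^sub>R \<phi> x \<partial>m) \<le> (\<integral>x. norm (g x *\<^sub>R \<phi> x) \<partial>m)"
    by (rule integral_norm_bound)
  also have "\<dots> \<le> (\<integral>x. c * \<bar>g x\<bar> \<partial>m)"
    by (intro integral_mono_AE integrable_norm[OF intg] int AE[OF c])
  finally show "norm (\<integral>x. g x *\<^sub>R \<phi> x \<partial>m) \<le> c * (\<integral>x. \<bar>g x\<bar> \<partial>m)" by simp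
qed

lemma test_fun_AE:
  assumes "test_fun g" "locally_AE m P"
  shows "AE x in m. g x \<noteq> 0 \<longrightarrow> P x"
proof -
  obtain A where A: "A \<in> sets m" "emeasure m A < \<infinity>" "\<And>x. x \<notin> A \<Longrightarrow> g x = 0"
    using assms(1) by (rule test_funE) blast
  then have "AE x\<in>A in m. P x" using assms(2) by (auto simp: locally_AE_def)
  then show ?thesis by eventually_elim (use A in auto)
qed

text \<open>Every probability density gives a mean. The value 0 outside \<open>L_infinity m\<close>
  agrees with the default of \<open>essential_bound\<close>, so that the functional lies in the
  compact product.\<close>

lemma mean_of_density:
  assumes g: "test_fun g" "\<And>x. g x \<ge> 0" "(\<integral>x. g x \<partial>m) = 1"
  shows "mean_on_L_infinity m (\<lambda>\<phi>. if \<phi> \<in> L_infinity m then \<integral>x. g x *\<^sub>R \<phi> x \<partial>m else 0)"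
    (is "mean_on_L_infinity m ?\<Lambda>")
proof -
  note int = integrable_test_fun_L_infinity[OF g(1)]
  have eq: "(\<integral>x. g x *\<^sub>R \<phi> x \<partial>m) = (\<integral>x. g x *\<^sub>R \<psi> x \<partial>m)"
    if "\<phi> \<in> L_infinity m" "\<psi> \<in> L_infinity m" "locally_AE m (\<lambda>x. \<phi> x = \<psi> x)" for \<phi> \<psi>
    using test_fun_AE[OF g(1) that(3)] int[OF that(1)] int[OF that(2)]
    by (intro integral_cong_AE) auto
  have add: "(\<integral>x. g x *\<^sub>R (\<phi> x + \<psi> x) \<partial>m) = (\<integral>x. g x *\<^sub>R \<phi> x \<partial>m) + (\<integral>x. g x *\<^sub>R \<psi> x \<partial>m)"
    if "\<phi> \<in> L_infinity m" "\<psi> \<in> L_infinity m" for \<phi> \<psi>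
    using int[OF that(1)] int[OF that(2)] by (simp add: scaleR_add_right)
  have scale: "(\<integral>x. g x *\<^sub>R (a * \<phi> x) \<partial>m) = a * (\<integral>x. g x *\<^sub>R \<phi> x \<partial>m)" for a :: complex and \<phi>
    unfolding mult_scaleR_right[symmetric] by (rule integral_mult_right_zero)
  have pos: "(\<integral>x. g x *\<^sub>R \<phi> x \<partial>m) \<in> \<real>\<^sub>\<ge>\<^sub>0"
    if \<phi>: "\<phi> \<in> L_infinity m" and pos: "locally_AE m (\<lambda>x. \<phi> x \<in> \<real>\<^sub>\<ge>\<^sub>0)" for \<phi>
  proof -
    have AE: "AE x in m. g x \<noteq> 0 \<longrightarrow> \<phi> x \<in> \<real>\<^sub>\<ge>\<^sub>0" by (rule test_fun_AE[OF g(1) pos])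
    have "Re (\<integral>x. g x *\<^sub>R \<phi> x \<partial>m) = (\<integral>x. Re (g x *\<^sub>R \<phi> x) \<partial>m)"
      by (rule integral_Re[OF int[OF \<phi>], symmetric])
    also have "\<dots> \<ge> 0"
      by (rule integral_nonneg_AE, use AE in eventually_elim)
        (auto simp: complex_nonneg_Reals_iff g(2))
    finally have Re: "Re (\<integral>x. g x *\<^sub>R \<phi> x \<partial>m) \<ge> 0" .
    have "Im (\<integral>x. g x *\<^sub>R \<phi> x \<partial>m) = (\<integral>x. Im (g x *\<^sub>R \<phi> x) \<partial>m)"
      by (rule integral_Im[OF int[OF \<phi>], symmetric])
    also have "\<dots> = 0"
      by (rule integral_eq_zero_AE, use AE in eventually_elim)
        (auto simp: complex_nonneg_Reals_iff)
    finally show ?thesis using Re by (simp add: complex_nonneg_Reals_iff)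
  qed
  have one: "(\<integral>x. g x *\<^sub>R (1::complex) \<partial>m) = 1"
    using g(3) test_fun_integrable[OF g(1)] by simp
  show ?thesis
    unfolding mean_on_L_infinity_def linear_functional_on_L_infinity_def
  proof (intro conjI ballI allI impI)
    fix \<phi> \<psi> :: "'a \<Rightarrow> complex" and a :: complex
    assume \<phi>: "\<phi> \<in> L_infinity m"
    show "?\<Lambda> (\<lambda>x. a * \<phi> x) = a * ?\<Lambda> \<phi>"
      using \<phi> L_infinity_scale[OF \<phi>] scale by simp
    show "?\<Lambda> \<phi> \<in> \<real>\<^sub>\<ge>\<^sub>0" if "locally_AE m (\<lambda>x. \<phi> x \<in> \<real>\<^sub>\<ge>\<^sub>0)"
      using \<phi> pos[OF \<phi> that] by simp
    assume \<psi>: "\<psi> \<in> L_infinity m"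
    show "?\<Lambda> (\<lambda>x. \<phi> x + \<psi> x) = ?\<Lambda> \<phi> + ?\<Lambda> \<psi>"
      using \<phi> \<psi> L_infinity_add[OF \<phi> \<psi>] add[OF \<phi> \<psi>] by simp
    show "?\<Lambda> \<phi> = ?\<Lambda> \<psi>" if "locally_AE m (\<lambda>x. \<phi> x = \<psi> x)"
      using \<phi> \<psi> eq[OF \<phi> \<psi> that] by simp
  next
    show "?\<Lambda> (\<lambda>x. 1) = 1"
      using one L_infinity_const by simp
  qed
qed

text \<open>The means in the product of discs form a compact set, and invariance is the intersection
  of the closed conditions \<open>D (s, k)\<close>. Finitely many of them are satisfied by
  integration against one Reiter density.\<close>

lemma reiter_imp_amenable:
  assumes reiter_condition shows "amenable m"
proof -
  let ?b = "essential_bound m"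
  define X where "X = (PiE UNIV (\<lambda>\<phi>. cball 0 (?b \<phi>)) :: (('a \<Rightarrow> complex) \<Rightarrow> complex) set)
    \<inter> {\<Lambda>. mean_on_L_infinity m \<Lambda>}"
  define D where "D = (\<lambda>(s :: 'a, k :: nat). {\<Lambda> :: ('a \<Rightarrow> complex) \<Rightarrow> complex. \<forall>\<phi>\<in>L_infinity m.
    norm (\<Lambda> (\<lambda>x. \<phi> (s + x)) - \<Lambda> \<phi>) \<le> ?b \<phi> / real (Suc k)})"
  have "X \<inter> (\<Inter>i\<in>UNIV. D i) \<noteq> {}"
  proof (rule compact_imp_fip_image)
    show "compact X"
      unfolding X_def by (intro compact_Int_closed compact_PiE_UNIV closed_mean_on_L_infinity) simp
    fix i show "closed (D i)"
      unfolding D_def split_def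
      by (intro closed_Collect_Ball closed_Collect_le continuous_on_norm continuous_on_diff
          continuous_on_const continuous_on_product_coordinates)
  next
    fix I :: "('a \<times> nat) set" assume I: "finite I"
    \<comment> \<open>The strictest tolerance among the finitely many conditions; the inserted 0
      makes the maximum meaningful for empty \<open>I\<close>.\<close>
    define K where "K = Max (insert 0 (snd ` I))"
    obtain f where f: "test_fun f" "\<And>x. f x \<ge> 0" and inv:
      "(\<Sum>s\<in>fst ` I. \<integral>x. \<bar>f (- s + x) - f x\<bar> \<partial>m) < 1 / real (Suc K) * (\<integral>x. f x \<partial>m)"
      using assms[unfolded reiter_condition_def, rule_format, of "fst ` I" "1 / real (Suc K)"] I
      by auto
    have "0 \<le> (\<Sum>s\<in>fst ` I. \<integral>x. \<bar>f (- s + x) - f x\<bar> \<partial>m)" by (intro sum_nonneg) simp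
    then have "0 < 1 / real (Suc K) * (\<integral>x. f x \<partial>m)" using inv by (rule le_less_trans)
    then have If: "(\<integral>x. f x \<partial>m) > 0" by (rule zero_less_mult_pos) simp
    define g where "g = (\<lambda>x. 1 / (\<integral>x. f x \<partial>m) * f x)"
    have g: "test_fun g" "\<And>x. g x \<ge> 0" "(\<integral>x. g x \<partial>m) = 1"
      unfolding g_def using f If by (auto simp: test_fun_scale[of f "1 / _", simplified])
    define \<Lambda> where "\<Lambda> = (\<lambda>\<phi>. if \<phi> \<in> L_infinity m then \<integral>x. g x *\<^sub>R \<phi> x \<partial>m else 0)"
    have "\<Lambda> \<in> X"
      using mean_of_density[OF g] norm_integral_test_fun_le[OF g(1) _ essential_bound(2)] g
      by (auto simp: X_def \<Lambda>_def PiE_def essential_bound_def)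
    moreover have "\<Lambda> \<in> D (s, k)" if sk: "(s, k) \<in> I" for s k
      unfolding D_def
    proof (simp, intro ballI)
      fix \<phi> assume \<phi>: "\<phi> \<in> L_infinity m"
      have g': "test_fun (\<lambda>x. g (- s + x))" by (rule test_fun_translate[OF g(1)])
      note int = integrable_test_fun_L_infinity[OF g(1) \<phi>] integrable_test_fun_L_infinity[OF g' \<phi>]
      \<comment> \<open>Left invariance moves the translation from \<phi> to the density, where it
        becomes translation by the inverse.\<close>
      have "(\<integral>x. g x *\<^sub>R \<phi> (s + x) \<partial>m) = (\<integral>x. g (- s + x) *\<^sub>R \<phi> x \<partial>m)"
        using integral_translate[of "\<lambda>x. g (- s + x) *\<^sub>R \<phi> x" s] int(2)
        by (simp add: add.assoc[symmetric])
      then have "\<Lambda> (\<lambda>x. \<phi> (s + x)) - \<Lambda> \<phi> = (\<integral>x. (g (- s + x) - g x) *\<^sub>R \<phi> x \<partial>m)"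
        using \<phi> L_infinity_translate[OF \<phi>] int by (simp add: \<Lambda>_def scaleR_diff_left)
      also have "norm \<dots> \<le> ?b \<phi> * (\<integral>x. \<bar>g (- s + x) - g x\<bar> \<partial>m)"
        by (intro norm_integral_test_fun_le test_fun_diff g g' \<phi> essential_bound)
      also have "(\<integral>x. \<bar>g (- s + x) - g x\<bar> \<partial>m) \<le> 1 / real (Suc k)"
      proof -
        have "(\<integral>x. \<bar>g (- s + x) - g x\<bar> \<partial>m) = 1 / (\<integral>x. f x \<partial>m) * (\<integral>x. \<bar>f (- s + x) - f x\<bar> \<partial>m)"
          using If unfolding integral_mult_right_zero[symmetric]
          by (intro Bochner_Integration.integral_cong) (auto simp: g_def diff_divide_distrib[symmetric])
        also have "\<dots> \<le> 1 / (\<integral>x. f x \<partial>m) * (1 / real (Suc K) * (\<integral>x. f x \<partial>m))"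
        proof (intro mult_left_mono)
          have "(\<integral>x. \<bar>f (- s + x) - f x\<bar> \<partial>m) \<le> (\<Sum>s\<in>fst ` I. \<integral>x. \<bar>f (- s + x) - f x\<bar> \<partial>m)"
            using I sk by (intro member_le_sum) (auto simp: image_iff intro: bexI[of _ "(s, k)"])
          with inv show "(\<integral>x. \<bar>f (- s + x) - f x\<bar> \<partial>m) \<le> 1 / real (Suc K) * (\<integral>x. f x \<partial>m)"
            by linarith
        qed (use If in simp)
        also have "1 / (\<integral>x. f x \<partial>m) * (1 / real (Suc K) * (\<integral>x. f x \<partial>m)) = 1 / real (Suc K)"
          using If by simp
        also have "\<dots> \<le> 1 / real (Suc k)"
        proof -
          have "k \<le> K" unfolding K_def using I sk by (intro Max_ge) force+
          then show ?thesis by (intro divide_left_mono) auto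
        qed
        finally show ?thesis .
      qed
      finally show "cmod (\<Lambda> (\<lambda>x. \<phi> (s + x)) - \<Lambda> \<phi>) \<le> ?b \<phi> / (1 + real k)"
        using essential_bound(1)[OF \<phi>] by (simp add: mult_left_mono)
    qed
    ultimately show "X \<inter> (\<Inter>i\<in>I. D i) \<noteq> {}" by (auto simp del: split_paired_All)
  qed
  then obtain \<Lambda> where mean: "mean_on_L_infinity m \<Lambda>" and D: "\<And>i. \<Lambda> \<in> D i"
    by (auto simp: X_def)
  have "\<Lambda> (\<lambda>x. \<phi> (s + x)) = \<Lambda> \<phi>" if \<phi>: "\<phi> \<in> L_infinity m" for s \<phi>
  proof -
    have "norm (\<Lambda> (\<lambda>x. \<phi> (s + x)) - \<Lambda> \<phi>) \<le> ?b \<phi> / real (Suc k)" for k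
      using D[of "(s, k)"] \<phi> by (simp add: D_def)
    then have "norm (\<Lambda> (\<lambda>x. \<phi> (s + x)) - \<Lambda> \<phi>) \<le> 0"
      by (intro LIMSEQ_le_const[OF LIMSEQ_Suc[OF lim_const_over_n[of "?b \<phi>"]]]) auto
    then show ?thesis by simp
  qed
  with mean show ?thesis unfolding amenable_def by blast
qed

end

section \<open>A minimax lemma\<close>

text \<open>A differentiable replacement for the absolute value, accurate up to \<kappa>; its
  derivative is \<open>smooth_sgn\<close>.\<close>

definition smooth_abs :: "real \<Rightarrow> real \<Rightarrow> real" where
  "smooth_abs \<kappa> v = sqrt (v\<^sup>2 + \<kappa>\<^sup>2)"

definition smooth_sgn :: "real \<Rightarrow> real \<Rightarrow> real" where
  "smooth_sgn \<kappa> v = v / smooth_abs \<kappa> v"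

lemma smooth_abs_bounds:
  assumes "\<kappa> > 0"
  shows "\<kappa> \<le> smooth_abs \<kappa> v" "\<bar>v\<bar> \<le> smooth_abs \<kappa> v" "smooth_abs \<kappa> v \<le> \<bar>v\<bar> + \<kappa>"
proof -
  have "sqrt (\<kappa>\<^sup>2) \<le> sqrt (v\<^sup>2 + \<kappa>\<^sup>2)" by (rule real_sqrt_le_mono) simp
  then show "\<kappa> \<le> smooth_abs \<kappa> v" using assms by (simp add: smooth_abs_def)
  have "sqrt (v\<^sup>2) \<le> sqrt (v\<^sup>2 + \<kappa>\<^sup>2)" by (rule real_sqrt_le_mono) simp
  then show "\<bar>v\<bar> \<le> smooth_abs \<kappa> v" by (simp add: smooth_abs_def)
  have "sqrt (v\<^sup>2 + \<kappa>\<^sup>2) \<le> sqrt (v\<^sup>2) + sqrt (\<kappa>\<^sup>2)" by (rule sqrt_add_le_add_sqrt) auto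
  then show "smooth_abs \<kappa> v \<le> \<bar>v\<bar> + \<kappa>" using assms by (simp add: smooth_abs_def)
qed

text \<open>A Taylor bound with remainder governed by the curvature \<open>1 / \<kappa>\<close>,
  proved by squaring instead of differentiating.\<close>

lemma smooth_abs_add_le:
  assumes "\<kappa> > 0"
  shows "smooth_abs \<kappa> (v + e) \<le> smooth_abs \<kappa> v + e * smooth_sgn \<kappa> v + e\<^sup>2 / (2 * \<kappa>)"
proof -
  define h where "h = smooth_abs \<kappa> v"
  have h: "h \<ge> \<kappa>" "h > 0" using smooth_abs_bounds[OF assms, of v] assms by (auto simp: h_def)
  have h2: "h\<^sup>2 = v\<^sup>2 + \<kappa>\<^sup>2" by (simp add: h_def smooth_abs_def)
  \<comment> \<open>Concavity of the square root suggests
    \<open>sqrt (h^2 + q) \<le> h + q / (2 * h)\<close>, here with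
    \<open>q = 2 * e * v + e^2\<close>; the two squares differ by \<open>B^2\<close>.\<close>
  define B where "B = (2 * e * v + e\<^sup>2) / (2 * h)"
  have "h + B = (2 * h\<^sup>2 + 2 * e * v + e\<^sup>2) / (2 * h)"
    using h by (simp add: B_def field_simps power2_eq_square)
  also have "2 * h\<^sup>2 + 2 * e * v + e\<^sup>2 = h\<^sup>2 + \<kappa>\<^sup>2 + (v + e)\<^sup>2"
    by (simp add: h2 power2_sum)
  finally have "h + B \<ge> 0" using h by simp
  moreover have "(v + e)\<^sup>2 + \<kappa>\<^sup>2 \<le> (h + B)\<^sup>2"
  proof -
    have "2 * h * B = 2 * e * v + e\<^sup>2" using h by (simp add: B_def)
    then have "(h + B)\<^sup>2 = (v + e)\<^sup>2 + \<kappa>\<^sup>2 + B\<^sup>2" by (simp add: power2_sum h2)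
    then show ?thesis by simp
  qed
  ultimately have "smooth_abs \<kappa> (v + e) \<le> h + B"
    unfolding smooth_abs_def by (intro real_le_lsqrt) auto
  also have "B = e * (v / h) + e\<^sup>2 / (2 * h)" using h by (simp add: B_def field_simps)
  also have "e\<^sup>2 / (2 * h) \<le> e\<^sup>2 / (2 * \<kappa>)" using h assms by (intro divide_left_mono) auto
  finally show ?thesis by (simp add: h_def smooth_sgn_def)
qed

lemma smooth_sgn_bounds:
  assumes "\<kappa> > 0"
  shows "\<bar>smooth_sgn \<kappa> v\<bar> \<le> 1" "\<bar>v\<bar> - \<kappa> \<le> smooth_sgn \<kappa> v * v"
proof -
  define h where "h = smooth_abs \<kappa> v"
  have h: "h \<ge> \<kappa>" "h > 0" "\<bar>v\<bar> \<le> h"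
    using smooth_abs_bounds[OF assms, of v] assms by (auto simp: h_def)
  show "\<bar>smooth_sgn \<kappa> v\<bar> \<le> 1" using h by (simp add: smooth_sgn_def h_def[symmetric])
  have "v\<^sup>2 = h\<^sup>2 - \<kappa>\<^sup>2" by (simp add: h_def smooth_abs_def)
  then have "smooth_sgn \<kappa> v * v = h - \<kappa> * (\<kappa> / h)"
    using h by (simp add: smooth_sgn_def h_def[symmetric] field_simps power2_eq_square)
  moreover have "\<kappa> * (\<kappa> / h) \<le> \<kappa> * 1" using h assms by (intro mult_left_mono) auto
  ultimately show "\<bar>v\<bar> - \<kappa> \<le> smooth_sgn \<kappa> v * v" using h by simp
qed

lemma borel_measurable_smooth [measurable]:
  "smooth_abs \<kappa> \<in> borel_measurable borel" "smooth_sgn \<kappa> \<in> borel_measurable borel"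
  unfolding smooth_abs_def[abs_def] smooth_sgn_def[abs_def] by measurable

text \<open>
  The sum of the \<open>L\<^sup>1\<close> norms is smoothed so that it is differentiable in the weights. Testing a
  near-minimiser against the vertices of the simplex gives the inequalities below, \<open>\<phi>\<close> being the
  derivative of the smoothed absolute value.
\<close>

lemma (in finite_measure) finite_minimax:
  fixes g :: "'x \<Rightarrow> 's \<Rightarrow> 'a \<Rightarrow> real"
  assumes Q: "finite Q" "Q \<noteq> {}" and F: "finite F" and \<delta>: "\<delta> > 0"
    and g [measurable]: "\<And>x s. g x s \<in> borel_measurable M" and g1: "\<And>x s y. \<bar>g x s y\<bar> \<le> 1"
    and gap: "\<And>a. \<lbrakk>\<And>x. x \<in> Q \<Longrightarrow> a x \<ge> 0; sum a Q = 1\<rbrakk> \<Longrightarrow>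
      c \<le> (\<Sum>s\<in>F. \<integral>y. \<bar>\<Sum>x\<in>Q. a x * g x s y\<bar> \<partial>M)"
  obtains \<phi> where "\<And>s. \<phi> s \<in> borel_measurable M" "\<And>s y. \<bar>\<phi> s y\<bar> \<le> (1::real)"
    "\<And>x. x \<in> Q \<Longrightarrow> c - \<delta> \<le> (\<Sum>s\<in>F. \<integral>y. \<phi> s y * g x s y \<partial>M)"
proof -
  define V where "V = real (card F) * measure M (space M)"
  \<comment> \<open>The total mass \<open>V\<close> may be 0, for instance for empty
    \<open>F\<close>; \<open>W\<close> is a positive denominator that dominates it.\<close>
  define W where "W = V + 1"
  have V: "V \<ge> 0" "W > 0" "V \<le> W" by (simp_all add: V_def W_def add_nonneg_pos)
  \<comment> \<open>The error \<delta> is split into three equal parts: the smoothing error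
    \<open>\<kappa> * V\<close>, the Taylor remainder \<open>2 * t / \<kappa> * V\<close>, which
    determines \<open>t\<close>, and the near-minimality error after division by
    \<open>t\<close>.\<close>
  define \<kappa> where "\<kappa> = \<delta> / (3 * W)"
  have \<kappa>: "\<kappa> > 0" using \<delta> V by (simp add: \<kappa>_def)
  define t where "t = min 1 (\<kappa> * \<delta> / (6 * W))"
  have t: "t > 0" "t \<le> 1" using \<kappa> \<delta> V by (auto simp: t_def)
  define weights where "weights = {a :: 'x \<Rightarrow> real. (\<forall>x\<in>Q. a x \<ge> 0) \<and> sum a Q = 1}"
  define v where "v a s y = (\<Sum>x\<in>Q. a x * g x s y)" for a s y
  have v_meas [measurable]: "v a s \<in> borel_measurable M" for a s
    unfolding v_def by measurable
  have v1: "\<bar>v a s y\<bar> \<le> 1" if "a \<in> weights" for a s y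
  proof -
    have "\<bar>v a s y\<bar> \<le> (\<Sum>x\<in>Q. \<bar>a x * g x s y\<bar>)" unfolding v_def by (rule sum_abs)
    also have "\<dots> \<le> (\<Sum>x\<in>Q. a x * 1)"
      unfolding abs_mult using that g1 by (intro sum_mono mult_mono) (auto simp: weights_def)
    finally show ?thesis using that by (simp add: weights_def)
  qed
  define J where "J a = (\<Sum>s\<in>F. \<integral>y. smooth_abs \<kappa> (v a s y) \<partial>M)" for a
  have int_J: "integrable M (\<lambda>y. smooth_abs \<kappa> (v a s y))" if "a \<in> weights" for a s
  proof (rule integrable_const_bound[where B="1 + \<kappa>"])
    have "\<bar>smooth_abs \<kappa> (v a s y)\<bar> \<le> 1 + \<kappa>" for y
      using smooth_abs_bounds[OF \<kappa>, of "v a s y"] v1[OF that, of s y] \<kappa> by linarith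
    then show "AE y in M. norm (smooth_abs \<kappa> (v a s y)) \<le> 1 + \<kappa>" by simp
  qed measurable
  obtain x0 where x0: "x0 \<in> Q" using Q by blast
  have "(\<lambda>x. of_bool (x = x0)) \<in> weights" using Q x0 by (auto simp: weights_def)
  then have nonempty: "J ` weights \<noteq> {}" by blast
  have "J a \<ge> 0" for a unfolding J_def smooth_abs_def by (intro sum_nonneg) simp
  then have bdd: "bdd_below (J ` weights)" by (intro bdd_belowI[of _ 0]) auto
  \<comment> \<open>The near-minimality error carries a factor \<open>t\<close> because the
    comparison with a step of size \<open>t\<close> is divided by \<open>t\<close> in the
    end.\<close>
  have "Inf (J ` weights) < Inf (J ` weights) + \<delta> * t / 3" using \<delta> t by simp
  then obtain a where a: "a \<in> weights" and Ja: "J a < Inf (J ` weights) + \<delta> * t / 3"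
    using cInf_lessD[OF nonempty] by blast
  have near_min: "J a \<le> J b + \<delta> * t / 3" if "b \<in> weights" for b
    using cInf_lower[OF imageI[OF that] bdd] Ja by linarith
  define \<phi> where "\<phi> s y = smooth_sgn \<kappa> (v a s y)" for s y
  have \<phi>1: "\<bar>\<phi> s y\<bar> \<le> 1" for s y unfolding \<phi>_def by (rule smooth_sgn_bounds[OF \<kappa>])
  have \<phi>_meas [measurable]: "\<phi> s \<in> borel_measurable M" for s
    unfolding \<phi>_def[abs_def] by measurable
  have int_\<phi>: "integrable M (\<lambda>y. \<phi> s y * f y)"
    if [measurable]: "f \<in> borel_measurable M" and "\<And>y. \<bar>f y\<bar> \<le> D" for s f D
  proof (rule integrable_const_bound[where B="1 * D"])
    have "\<bar>\<phi> s y * f y\<bar> \<le> 1 * D" for y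
      unfolding abs_mult using that \<phi>1 by (intro mult_mono) auto
    then show "AE y in M. norm (\<phi> s y * f y) \<le> 1 * D" by simp
  qed measurable
  have "c - \<delta> \<le> (\<Sum>s\<in>F. \<integral>y. \<phi> s y * g x s y \<partial>M)" if x: "x \<in> Q" for x
  proof -
    \<comment> \<open>A step of size \<open>t\<close> from the near-minimiser \<open>a\<close>
      towards the vertex \<open>x\<close> of the simplex.\<close>
    define b where "b z = (1 - t) * a z + t * of_bool (z = x)" for z
    have "sum b Q = 1"
      using a x Q by (simp add: b_def sum.distrib sum_distrib_left[symmetric] weights_def)
    moreover have "b z \<ge> 0" if "z \<in> Q" for z
      using a t that by (simp add: b_def weights_def)
    ultimately have b: "b \<in> weights" by (simp add: weights_def)
    define d where "d s y = g x s y - v a s y" for s y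
    have [measurable]: "d s \<in> borel_measurable M" for s unfolding d_def[abs_def] by measurable
    have d2: "\<bar>d s y\<bar> \<le> 2" for s y
      using g1[of x s y] v1[OF a, of s y] by (simp add: d_def)
    have vb: "v b s y = v a s y + t * d s y" for s y
    proof -
      have "v b s y = (\<Sum>z\<in>Q. (1 - t) * (a z * g z s y) + t * (of_bool (z = x) * g z s y))"
        unfolding v_def b_def by (intro sum.cong) (auto simp: algebra_simps)
      also have "\<dots> = (1 - t) * v a s y + t * (\<Sum>z\<in>Q. of_bool (z = x) * g z s y)"
        by (simp add: sum.distrib sum_distrib_left v_def)
      also have "(\<Sum>z\<in>Q. of_bool (z = x) * g z s y) = (\<Sum>z\<in>Q. if z = x then g z s y else 0)"
        by (intro sum.cong) auto
      also have "\<dots> = g x s y" using x Q by simp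
      finally show ?thesis by (simp add: d_def algebra_simps)
    qed
    define D where "D = (\<Sum>s\<in>F. \<integral>y. \<phi> s y * d s y \<partial>M)"
    \<comment> \<open>Along this step \<open>D\<close> is the derivative of \<open>J\<close>; the
      remainder comes from \<open>\<bar>d s y\<bar> \<le> 2\<close>.\<close>
    have "J b \<le> (\<Sum>s\<in>F. \<integral>y. smooth_abs \<kappa> (v a s y) + t * (\<phi> s y * d s y) + 2 * t\<^sup>2 / \<kappa> \<partial>M)"
      unfolding J_def
    proof (intro sum_mono integral_mono int_J b Bochner_Integration.integrable_add
        integrable_mult_right a int_\<phi>[OF _ d2] integrable_const)
      fix s y
      have "(t * d s y)\<^sup>2 \<le> t\<^sup>2 * 2\<^sup>2"
        unfolding power_mult_distrib using power_mono[OF d2[of s y], of 2]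
        by (intro mult_left_mono) auto
      then have "(t * d s y)\<^sup>2 / (2 * \<kappa>) \<le> 2 * t\<^sup>2 / \<kappa>"
        using \<kappa> by (simp add: field_simps)
      then show "smooth_abs \<kappa> (v b s y) \<le> smooth_abs \<kappa> (v a s y) + t * (\<phi> s y * d s y) + 2 * t\<^sup>2 / \<kappa>"
        using smooth_abs_add_le[OF \<kappa>, of "v a s y" "t * d s y"]
        by (simp add: vb \<phi>_def mult_ac)
    qed measurable
    also have "\<dots> = (\<Sum>s\<in>F. (\<integral>y. smooth_abs \<kappa> (v a s y) \<partial>M) + t * (\<integral>y. \<phi> s y * d s y \<partial>M)
        + 2 * t\<^sup>2 / \<kappa> * measure M (space M))"
      by (intro sum.cong refl) (simp add: int_J[OF a] int_\<phi>[OF _ d2] mult.commute)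
    also have "\<dots> = J a + t * D + 2 * t\<^sup>2 / \<kappa> * V"
      by (simp add: sum.distrib J_def D_def V_def sum_distrib_left mult_ac)
    finally have "J a \<le> J a + t * D + 2 * t\<^sup>2 / \<kappa> * V + \<delta> * t / 3"
      using near_min[OF b] by linarith
    then have "0 \<le> t * (D + 2 * t / \<kappa> * V + \<delta> / 3)"
      by (simp add: algebra_simps power2_eq_square)
    then have D: "0 \<le> D + 2 * t / \<kappa> * V + \<delta> / 3" using t by (simp add: zero_le_mult_iff)
    have "2 * t / \<kappa> * V \<le> 2 * (\<kappa> * \<delta> / (6 * W)) / \<kappa> * V"
    proof (intro mult_right_mono divide_right_mono mult_left_mono)
      show "t \<le> \<kappa> * \<delta> / (6 * W)" by (simp add: t_def)
    qed (use \<kappa> V in auto)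
    also have "\<dots> = \<delta> / 3 * (V / W)" using \<kappa> V by (simp add: field_simps)
    also have "\<dots> \<le> \<delta> / 3 * 1" using \<delta> V by (intro mult_left_mono) auto
    finally have D': "D \<ge> - (2 * \<delta> / 3)" using D by simp
    \<comment> \<open>Pairing \<phi> with \<open>v a\<close> recovers the gap up to smoothing.
      Adding \<open>D\<close> replaces \<open>v a\<close> by \<open>g x\<close>, as
      \<open>v a s y + d s y = g x s y\<close>.\<close>
    have "c - \<kappa> * V \<le> (\<Sum>s\<in>F. \<integral>y. \<bar>v a s y\<bar> \<partial>M) - \<kappa> * V"
      using gap[of a] a by (simp add: weights_def v_def)
    also have "\<dots> = (\<Sum>s\<in>F. \<integral>y. \<bar>v a s y\<bar> - \<kappa> \<partial>M)"
    proof -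
      have "integrable M (\<lambda>y. \<bar>v a s y\<bar>)" for s
        using v1[OF a] by (intro integrable_const_bound[where B=1]) auto
      then show ?thesis by (simp add: sum_subtractf V_def mult_ac)
    qed
    also have "\<dots> \<le> (\<Sum>s\<in>F. \<integral>y. \<phi> s y * v a s y \<partial>M)"
    proof (intro sum_mono integral_mono int_\<phi>[OF _ v1[OF a]])
      fix s
      show "integrable M (\<lambda>y. \<bar>v a s y\<bar> - \<kappa>)"
        using v1[OF a] by (intro Bochner_Integration.integrable_diff integrable_const
            integrable_const_bound[where B=1]) auto
      show "\<bar>v a s y\<bar> - \<kappa> \<le> \<phi> s y * v a s y" for y
        unfolding \<phi>_def by (rule smooth_sgn_bounds[OF \<kappa>])
    qed measurable
    also have "\<dots> + D = (\<Sum>s\<in>F. \<integral>y. \<phi> s y * g x s y \<partial>M)"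
      unfolding D_def sum.distrib[symmetric]
    proof (intro sum.cong refl)
      fix s
      have "(\<integral>y. \<phi> s y * v a s y \<partial>M) + (\<integral>y. \<phi> s y * d s y \<partial>M)
          = (\<integral>y. \<phi> s y * v a s y + \<phi> s y * d s y \<partial>M)"
        by (intro Bochner_Integration.integral_add[symmetric] int_\<phi>[OF _ v1[OF a]] int_\<phi>[OF _ d2])
          measurable
      also have "(\<lambda>y. \<phi> s y * v a s y + \<phi> s y * d s y) = (\<lambda>y. \<phi> s y * g x s y)"
        by (simp add: d_def algebra_simps fun_eq_iff)
      finally show "(\<integral>y. \<phi> s y * v a s y \<partial>M) + (\<integral>y. \<phi> s y * d s y \<partial>M)
          = (\<integral>y. \<phi> s y * g x s y \<partial>M)" .
    qed
    finally have "c - \<kappa> * V + D \<le> (\<Sum>s\<in>F. \<integral>y. \<phi> s y * g x s y \<partial>M)" by simp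
    moreover have "\<kappa> * V \<le> \<delta> / 3"
    proof -
      have "\<kappa> * V = \<delta> / 3 * (V / W)" using V by (simp add: \<kappa>_def field_simps)
      also have "\<dots> \<le> \<delta> / 3 * 1" using \<delta> V by (intro mult_left_mono) auto
      finally show ?thesis by simp
    qed
    ultimately show ?thesis using D' by linarith
  qed
  with \<phi>_meas \<phi>1 show thesis by (rule that)
qed

section \<open>Potentials on an amenable group\<close>

lemma
  assumes "mean_on_L_infinity M \<Lambda>" "\<phi> \<in> L_infinity M"
  shows mean_add: "\<psi> \<in> L_infinity M \<Longrightarrow> \<Lambda> (\<lambda>x. \<phi> x + \<psi> x) = \<Lambda> \<phi> + \<Lambda> \<psi>"
    and mean_scale: "\<Lambda> (\<lambda>x. a * \<phi> x) = a * \<Lambda> \<phi>"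
  using assms unfolding mean_on_L_infinity_def linear_functional_on_L_infinity_def by simp_all

text \<open>Membership in \<open>L_infinity\<close> is carried through the induction because
  additivity of the mean is available only there.\<close>

lemma mean_sum:
  assumes \<Lambda>: "mean_on_L_infinity M \<Lambda>" and "finite I" "\<And>i. i \<in> I \<Longrightarrow> f i \<in> L_infinity M"
  shows "(\<lambda>x. \<Sum>i\<in>I. f i x) \<in> L_infinity M \<and> \<Lambda> (\<lambda>x. \<Sum>i\<in>I. f i x) = (\<Sum>i\<in>I. \<Lambda> (f i))"
  using assms(2,3)
proof (induction I)
  case empty
  have "\<Lambda> (\<lambda>x. 0 * 1) = 0 * \<Lambda> (\<lambda>x. 1)"
    by (rule mean_scale[OF \<Lambda> L_infinity_const])
  then show ?case by (simp add: L_infinity_const)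
next
  case (insert i I)
  then have "\<Lambda> (\<lambda>x. f i x + (\<Sum>i\<in>I. f i x)) = \<Lambda> (f i) + \<Lambda> (\<lambda>x. \<Sum>i\<in>I. f i x)"
    by (intro mean_add[OF \<Lambda>]) auto
  then show ?case using insert by (auto intro: L_infinity_add)
qed

text \<open>The counted levels are the integers in a half-open interval from \<open>N * q\<close> to
  \<open>N * p\<close>, empty or of length at most \<open>N * \<bar>p - q\<bar>\<close>; the 1
  covers rounding.\<close>

lemma levels_difference_le:
  fixes p q :: real
  assumes "p \<ge> 0" "q \<ge> 0"
  shows "(\<Sum>k=1..N. of_bool (real k \<le> real N * p \<and> \<not> real k \<le> real N * q)) \<le> real N * \<bar>p - q\<bar> + 1"
proof -
  let ?A = "{k \<in> {1..N}. real k \<le> real N * p \<and> \<not> real k \<le> real N * q}"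
  have "(\<Sum>k=1..N. of_bool (real k \<le> real N * p \<and> \<not> real k \<le> real N * q)) = real (card ?A)"
    by (simp add: of_bool_def sum.If_cases Int_def)
  also have "card ?A \<le> card {nat \<lfloor>real N * q\<rfloor> + 1..nat \<lfloor>real N * p\<rfloor>}"
    using assms by (intro card_mono) (auto simp: le_nat_floor nat_less_iff Suc_le_eq floor_less_iff)
  also have "real (card {nat \<lfloor>real N * q\<rfloor> + 1..nat \<lfloor>real N * p\<rfloor>}) \<le> real N * \<bar>p - q\<bar> + 1"
  proof (cases "nat \<lfloor>real N * q\<rfloor> \<le> nat \<lfloor>real N * p\<rfloor>")
    case True
    have "real (nat \<lfloor>real N * p\<rfloor>) \<le> real N * p" "real N * q \<le> real (nat \<lfloor>real N * q\<rfloor>) + 1"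
      using assms by (simp_all add: of_nat_floor)
    moreover have "real N * (p - q) \<le> real N * \<bar>p - q\<bar>" by (intro mult_left_mono) auto
    ultimately show ?thesis using True by (simp add: of_nat_diff algebra_simps)
  qed simp
  finally show ?thesis by simp
qed

text \<open>Discrete layer-cake formula with rounding error 1. As \<open>p \<le> 1\<close>, all
  positive integers up to \<open>N * p\<close> are among the levels.\<close>

lemma levels_ge:
  fixes p :: real
  assumes "p \<ge> 0" "p \<le> 1"
  shows "real N * p - 1 \<le> (\<Sum>k=1..N. of_bool (real k \<le> real N * p))"
proof -
  have "real N * p \<le> real N" using mult_left_mono[OF assms(2), of "real N"] by simp
  then have sub: "{1..nat \<lfloor>real N * p\<rfloor>} \<subseteq> {k \<in> {1..N}. real k \<le> real N * p}"
    using assms by (auto simp: le_nat_iff le_floor_iff)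
  have "real N * p - 1 \<le> real (nat \<lfloor>real N * p\<rfloor>)" by linarith
  also have "\<dots> = real (card {1..nat \<lfloor>real N * p\<rfloor>})" by simp
  also have "\<dots> \<le> real (card {k \<in> {1..N}. real k \<le> real N * p})"
    using card_mono[OF _ sub] by simp
  also have "\<dots> = (\<Sum>k=1..N. of_bool (real k \<le> real N * p))"
    by (simp add: of_bool_def sum.If_cases Int_def)
  finally show ?thesis .
qed

section \<open>Continuity of translation in \<open>L^1\<close>\<close>

context haar
begin

text \<open>The tube lemma applied to the preimage of \<open>U\<close> under addition, which
  contains \<open>{0} \<times> K\<close>.\<close>

lemma compact_translate_into_open:
  fixes K :: "'a set"
  assumes "compact K" "open U" "K \<subseteq> U"
  obtains W where "open W" "0 \<in> W" "\<And>w. w \<in> W \<Longrightarrow> (+) w ` K \<subseteq> U"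
proof -
  let ?P = "(\<lambda>z. fst z + snd z) -` U :: ('a \<times> 'a) set"
  have "open ?P" using assms(2) by (intro open_vimage continuous_intros)
  then have P: "openin (prod_topology euclidean euclidean) ?P" "{0} \<times> K \<subseteq> ?P"
    using assms(3) by auto
  have "compactin euclidean {0 :: 'a}" "compactin euclidean K" using assms(1) by simp_all
  then obtain W V where "openin euclidean W" "openin euclidean V" "{0} \<subseteq> W" "K \<subseteq> V" "W \<times> V \<subseteq> ?P"
    by (rule Wallace_theorem_prod_topology[OF _ _ P])
  moreover have "w + k \<in> U" if "w \<in> W" "k \<in> K" for w k
  proof -
    have "(w, k) \<in> W \<times> V" using that \<open>K \<subseteq> V\<close> by blast
    then have "(w, k) \<in> ?P" using \<open>W \<times> V \<subseteq> ?P\<close> by blast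
    then show ?thesis by simp
  qed
  ultimately show thesis by (intro that[of W]) auto
qed

text \<open>For compact \<open>K\<close> this is the measure of a symmetric difference. It is
  invariant under left translation and serves as one modulus of continuity for all
  potentials.\<close>

definition translate_dist :: "'a set \<Rightarrow> 'a \<Rightarrow> 'a \<Rightarrow> real" where
  "translate_dist K x y = (\<integral>z. \<bar>indicator ((+) x ` K) z - indicator ((+) y ` K) z\<bar> \<partial>m)"

lemma indicator_translate: "indicator ((+) (s + x) ` K) z = indicator ((+) x ` K) (- s + z)" for x :: 'a
proof -
  have "z \<in> (+) (s + x) ` K \<longleftrightarrow> - s + z \<in> (+) x ` K"
    unfolding image_add_eq_vimage vimage_eq minus_add add.assoc ..
  then show ?thesis by (simp add: indicator_def)
qed

lemma test_fun_indicator_translate: "compact K \<Longrightarrow> test_fun (indicator ((+) x ` K))"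
  by (intro test_fun_indicator compact_fmeasurable compact_translate)

lemma translate_dist_add:
  assumes "compact K" shows "translate_dist K (s + x) (s + y) = translate_dist K x y"
  unfolding translate_dist_def indicator_translate
  by (rule integral_translate[where h="\<lambda>z. \<bar>indicator ((+) x ` K) z - indicator ((+) y ` K) z\<bar>"])
    (intro test_fun_measurable test_fun_intros test_fun_indicator_translate assms)

text \<open>Outer regularity gives an open \<open>U\<close> around \<open>K\<close> with excess less
  than \<open>\<epsilon> / 2\<close>. For \<open>w\<close> near 0 also \<open>w + K\<close> lies in
  \<open>U\<close>, and each of the two sets misses less than \<open>\<epsilon> / 2\<close> of
  it.\<close>

lemma translate_dist_small:
  assumes K: "compact K" and \<epsilon>: "\<epsilon> > 0"
  obtains W where "open W" "0 \<in> W" "\<And>w. w \<in> W \<Longrightarrow> translate_dist K w 0 < \<epsilon>"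
proof -
  have eK: "emeasure m K = ennreal (measure m K)"
    using compact_finite[OF K] by (intro emeasure_eq_ennreal_measure) auto
  have "(INF U\<in>{U. open U \<and> K \<subseteq> U}. emeasure m U) = emeasure m K"
    using haar compact_borel[OF K] unfolding left_haar_measure_def by auto
  also have "\<dots> < ennreal (measure m K + \<epsilon> / 2)"
    unfolding eK using \<epsilon> by (intro ennreal_lessI) (auto intro: add_nonneg_pos)
  finally obtain U where U: "open U" "K \<subseteq> U" and mU: "emeasure m U < ennreal (measure m K + \<epsilon> / 2)"
    unfolding INF_less_iff by blast
  have "emeasure m U < \<infinity>" using mU by (rule less_trans) simp
  then have fU: "U \<in> fmeasurable m" using U by (auto simp: fmeasurable_def)
  have "ennreal (measure m U) < ennreal (measure m K + \<epsilon> / 2)"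
    using mU \<open>emeasure m U < \<infinity>\<close> by (subst emeasure_eq_ennreal_measure[symmetric]) auto
  then have mU': "measure m U < measure m K + \<epsilon> / 2"
    by (simp add: ennreal_less_iff)
  obtain W where W: "open W" "0 \<in> W" "\<And>w. w \<in> W \<Longrightarrow> (+) w ` K \<subseteq> U"
    using compact_translate_into_open[OF K U] by blast
  show thesis
  proof (rule that[OF W(1,2)])
    fix w assume "w \<in> W"
    then have wK: "(+) w ` K \<subseteq> U" by (rule W)
    note intros = test_fun_integrable test_fun_intros test_fun_indicator_translate K test_fun_indicator fU
    have diff: "(\<integral>z. (indicator U z :: real) - indicator ((+) y ` K) z \<partial>m) = measure m U - measure m K" for y
    proof -
      have "(\<integral>z. (indicator U z :: real) - indicator ((+) y ` K) z \<partial>m)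
          = (\<integral>z. indicator U z \<partial>m) - (\<integral>z. indicator ((+) y ` K) z \<partial>m)"
        by (intro Bochner_Integration.integral_diff intros)
      then show ?thesis using K by (simp add: measure_translate compact_borel)
    qed
    have "translate_dist K w 0 \<le> (\<integral>z. (indicator U z - indicator ((+) w ` K) z)
        + (indicator U z - indicator ((+) 0 ` K) z) \<partial>m)"
      unfolding translate_dist_def
      using wK U(2) by (intro integral_mono intros) (auto simp: indicator_def)
    also have "\<dots> = (\<integral>z. indicator U z - indicator ((+) w ` K) z \<partial>m)
        + (\<integral>z. indicator U z - indicator ((+) 0 ` K) z \<partial>m)"
      by (intro Bochner_Integration.integral_add intros)
    finally show "translate_dist K w 0 < \<epsilon>" unfolding diff using mU' by simp
  qed
qed

text \<open>Integrating the minimax functions over translates of \<open>K\<close> turns them into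
  functions of the translating element. Their size and modulus of continuity are then bounded
  independently of \<open>Q\<close>, as needed to pass to a limit.\<close>

lemma finite_potential:
  assumes K: "compact K" and F: "finite F" and Q: "finite Q" "Q \<noteq> {}" and c: "c > 0"
    and gap: "\<And>a. \<lbrakk>\<And>x. x \<in> Q \<Longrightarrow> a x \<ge> 0; sum a Q = 1\<rbrakk> \<Longrightarrow> c \<le> (\<Sum>s\<in>F. \<integral>y. \<bar>\<Sum>x\<in>Q.
      a x * (indicator ((+) (s + x) ` K) y - indicator ((+) x ` K) y)\<bar> \<partial>m)"
  obtains \<Phi> :: "'a \<times> 'a \<Rightarrow> real" where
    "\<And>x s. \<bar>\<Phi> (x, s)\<bar> \<le> measure m K"
    "\<And>x y s. \<bar>\<Phi> (x, s) - \<Phi> (y, s)\<bar> \<le> translate_dist K x y"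
    "\<And>x. x \<in> Q \<Longrightarrow> c / 2 \<le> (\<Sum>s\<in>F. \<Phi> (s + x, s) - \<Phi> (x, s))"
proof -
  define u :: "'a \<Rightarrow> 'a \<Rightarrow> real" where "u x = indicator ((+) x ` K)" for x
  have u: "test_fun (u x)" for x unfolding u_def by (rule test_fun_indicator_translate[OF K])
  \<comment> \<open>All translates occurring in the gap lie in \<open>L\<close>, so the minimax
    lemma, which needs a finite measure, can be applied on \<open>L\<close>.\<close>
  define L where "L = (\<Union>x\<in>Q. (+) x ` K) \<union> (\<Union>s\<in>F. \<Union>x\<in>Q. (+) (s + x) ` K)"
  have "compact L" unfolding L_def using Q F K by (intro compact_Un compact_UN compact_translate)
  then have L: "L \<in> sets m" "emeasure m L < \<infinity>" using compact_borel compact_finite by auto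
  define g where "g x s y = indicator L y * (u (s + x) y - u x y)" for x s y
  have g: "test_fun (g x s)" for x s unfolding g_def[abs_def]
    by (intro test_fun_times test_fun_diff u test_fun_indicator compact_fmeasurable \<open>compact L\<close>)
  have g_eq: "g x s y = u (s + x) y - u x y" if "x \<in> Q" "s \<in> F" for x s y
    using that unfolding g_def u_def L_def indicator_def by auto
  \<comment> \<open>A density keeps all measurable sets, so functions obtained for \<open>N\<close>
    are measurable for \<open>m\<close> as well.\<close>
  define N where "N = density m (\<lambda>y. ennreal (indicator L y))"
  have sets_N [simp, measurable_cong]: "sets N = sets m" by (simp add: N_def)
  have int_N: "(\<integral>y. h y \<partial>N) = (\<integral>y. indicator L y * h y \<partial>m)" if "h \<in> borel_measurable m" for h :: "'a \<Rightarrow> real"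
    unfolding N_def using that L by (subst integral_density) auto
  interpret N: finite_measure N
  proof
    have "emeasure N (space N) = emeasure m L"
      unfolding N_def using L by (subst emeasure_density) (auto simp: ennreal_indicator)
    then show "emeasure N (space N) \<noteq> \<infinity>" using L by simp
  qed
  have L_g: "indicator L y * g x s y = g x s y" for x s y by (simp add: g_def indicator_def)
  have gap_N: "c \<le> (\<Sum>s\<in>F. \<integral>y. \<bar>\<Sum>x\<in>Q. a x * g x s y\<bar> \<partial>N)"
    if "\<And>x. x \<in> Q \<Longrightarrow> a x \<ge> 0" "sum a Q = 1" for a
  proof -
    have "(\<integral>y. \<bar>\<Sum>x\<in>Q. a x * g x s y\<bar> \<partial>N) = (\<integral>y. \<bar>\<Sum>x\<in>Q. a x * (u (s + x) y - u x y)\<bar> \<partial>m)"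
      if "s \<in> F" for s
    proof -
      have "(\<integral>y. \<bar>\<Sum>x\<in>Q. a x * g x s y\<bar> \<partial>N) = (\<integral>y. indicator L y * \<bar>\<Sum>x\<in>Q. a x * g x s y\<bar> \<partial>m)"
        by (intro int_N test_fun_measurable test_fun_intros g)
      also have "\<dots> = (\<integral>y. \<bar>\<Sum>x\<in>Q. a x * (indicator L y * g x s y)\<bar> \<partial>m)"
        by (intro Bochner_Integration.integral_cong refl) (auto simp: indicator_def)
      also have "\<dots> = (\<integral>y. \<bar>\<Sum>x\<in>Q. a x * (u (s + x) y - u x y)\<bar> \<partial>m)"
        unfolding L_g using that g_eq by (simp cong: sum.cong)
      finally show ?thesis .
    qed
    then show ?thesis using gap[OF that] by (simp add: u_def)
  qed
  have g_meas: "g x s \<in> borel_measurable N" for x s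
    using test_fun_measurable[OF g] by simp
  have g1: "\<bar>g x s y\<bar> \<le> 1" for x s y by (auto simp: g_def u_def indicator_def)
  obtain \<phi> where \<phi>: "\<And>s. \<phi> s \<in> borel_measurable N" "\<And>s y. \<bar>\<phi> s y\<bar> \<le> (1::real)"
    and \<phi>_gap: "\<And>x. x \<in> Q \<Longrightarrow> c - c / 2 \<le> (\<Sum>s\<in>F. \<integral>y. \<phi> s y * g x s y \<partial>N)"
    using N.finite_minimax[OF Q F half_gt_zero[OF c] g_meas g1 gap_N] by blast
  have \<phi>m: "\<phi> s \<in> borel_measurable m" for s using \<phi>(1)[of s] by simp
  have test: "test_fun (\<lambda>y. \<phi> s y * f y)" if "test_fun f" for s f
    using test_fun_mult(2)[OF that \<phi>m \<phi>(2)] .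
  \<comment> \<open>Defined for all \<open>x\<close>, not only on \<open>Q\<close>. The cutoff by
    \<open>L\<close> can only decrease absolute values, so the first two bounds hold
    globally.\<close>
  define \<Phi> where "\<Phi> = (\<lambda>(x, s). \<integral>y. \<phi> s y * (indicator L y * u x y) \<partial>m)"
  have uL: "test_fun (\<lambda>y. indicator L y * u x y)" for x
    by (intro test_fun_times u test_fun_indicator compact_fmeasurable \<open>compact L\<close>)
  have diff: "\<Phi> (x, s) - \<Phi> (y, s) = (\<integral>z. \<phi> s z * (indicator L z * (u x z - u y z)) \<partial>m)" for x y s
  proof -
    have "\<Phi> (x, s) - \<Phi> (y, s)
        = (\<integral>z. \<phi> s z * (indicator L z * u x z) - \<phi> s z * (indicator L z * u y z) \<partial>m)"
      unfolding \<Phi>_def split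
      by (intro Bochner_Integration.integral_diff[symmetric] test_fun_integrable test uL)
    then show ?thesis by (simp add: right_diff_distrib)
  qed
  have bound: "\<bar>\<integral>z. \<phi> s z * (indicator L z * f z) \<partial>m\<bar> \<le> (\<integral>z. \<bar>f z\<bar> \<partial>m)"
    if f: "test_fun f" for f s
  proof -
    have "\<bar>\<integral>z. \<phi> s z * (indicator L z * f z) \<partial>m\<bar> \<le> (\<integral>z. \<bar>\<phi> s z * (indicator L z * f z)\<bar> \<partial>m)"
      by (rule integral_abs_bound)
    also have "\<dots> \<le> (\<integral>z. \<bar>f z\<bar> \<partial>m)"
    proof (intro integral_mono test_fun_integrable test_fun_abs test test_fun_times f
        test_fun_indicator compact_fmeasurable \<open>compact L\<close>)
      fix z
      have "\<bar>\<phi> s z\<bar> * \<bar>indicator L z * f z\<bar> \<le> 1 * \<bar>f z\<bar>"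
        using \<phi>(2) by (intro mult_mono) (auto simp: indicator_def)
      then show "\<bar>\<phi> s z * (indicator L z * f z)\<bar> \<le> \<bar>f z\<bar>" by (simp add: abs_mult)
    qed
    finally show ?thesis .
  qed
  show thesis
  proof (rule that[of \<Phi>])
    fix x y s
    have "\<bar>\<Phi> (x, s)\<bar> \<le> (\<integral>z. \<bar>u x z\<bar> \<partial>m)" using bound[OF u, of s x] by (simp add: \<Phi>_def)
    also have "\<dots> = measure m K" using K by (simp add: u_def measure_translate compact_borel)
    finally show "\<bar>\<Phi> (x, s)\<bar> \<le> measure m K" .
    show "\<bar>\<Phi> (x, s) - \<Phi> (y, s)\<bar> \<le> translate_dist K x y"
      unfolding diff using bound[OF test_fun_diff[OF u u], of s x y]
      by (simp add: translate_dist_def u_def)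
  next
    fix x assume x: "x \<in> Q"
    have "c / 2 \<le> (\<Sum>s\<in>F. \<integral>y. \<phi> s y * g x s y \<partial>N)" using \<phi>_gap[OF x] by simp
    also have "\<dots> = (\<Sum>s\<in>F. \<Phi> (s + x, s) - \<Phi> (x, s))"
    proof (intro sum.cong refl)
      fix s
      have "(\<integral>y. \<phi> s y * g x s y \<partial>N) = (\<integral>y. indicator L y * (\<phi> s y * g x s y) \<partial>m)"
        by (intro int_N test_fun_measurable test g)
      also have "\<dots> = (\<integral>y. \<phi> s y * (indicator L y * (u (s + x) y - u x y)) \<partial>m)"
        by (intro Bochner_Integration.integral_cong refl) (auto simp: g_def indicator_def)
      finally show "(\<integral>y. \<phi> s y * g x s y \<partial>N) = \<Phi> (s + x, s) - \<Phi> (x, s)" by (simp add: diff)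
    qed
    finally show "c / 2 \<le> (\<Sum>s\<in>F. \<Phi> (s + x, s) - \<Phi> (x, s))" .
  qed
qed

text \<open>The uniform bounds define a compact set \<open>X\<close> of functions. The inequality at
  each \<open>x\<close> is a closed condition, and finitely many of them are met by a finite
  potential.\<close>

lemma global_potential:
  assumes K: "compact K" and F: "finite F" and c: "c > 0"
    and gap: "\<And>Q a. \<lbrakk>finite Q; \<And>x. x \<in> Q \<Longrightarrow> a x \<ge> 0; sum a Q = 1\<rbrakk> \<Longrightarrow> c \<le> (\<Sum>s\<in>F. \<integral>y. \<bar>\<Sum>x\<in>Q.
      a x * (indicator ((+) (s + x) ` K) y - indicator ((+) x ` K) y)\<bar> \<partial>m)"
  obtains \<Phi> :: "'a \<times> 'a \<Rightarrow> real" where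
    "\<And>x s. \<bar>\<Phi> (x, s)\<bar> \<le> measure m K"
    "\<And>x y s. \<bar>\<Phi> (x, s) - \<Phi> (y, s)\<bar> \<le> translate_dist K x y"
    "\<And>x. c / 2 \<le> (\<Sum>s\<in>F. \<Phi> (s + x, s) - \<Phi> (x, s))"
proof -
  define X :: "('a \<times> 'a \<Rightarrow> real) set" where
    "X = PiE UNIV (\<lambda>_. cball 0 (measure m K)) \<inter>
      {\<Phi>. \<forall>x y s. \<bar>\<Phi> (x, s) - \<Phi> (y, s)\<bar> \<le> translate_dist K x y}"
  define Z :: "'a \<Rightarrow> ('a \<times> 'a \<Rightarrow> real) set" where
    "Z x = {\<Phi>. c / 2 \<le> (\<Sum>s\<in>F. \<Phi> (s + x, s) - \<Phi> (x, s))}" for x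
  have "X \<inter> (\<Inter>x\<in>UNIV. Z x) \<noteq> {}"
  proof (rule compact_imp_fip_image)
    show "compact X"
      unfolding X_def by (intro compact_Int_closed compact_PiE_UNIV compact_cball closed_Collect_all
          closed_Collect_le continuous_on_rabs continuous_on_diff continuous_on_const
          continuous_on_product_coordinates)
    show "closed (Z x)" for x
      unfolding Z_def by (intro closed_Collect_le continuous_on_sum continuous_on_diff
          continuous_on_const continuous_on_product_coordinates)
  next
    fix I :: "'a set" assume I: "finite I"
    \<comment> \<open>The point 0 is inserted because the finite version asks for a nonempty
      set.\<close>
    obtain \<Phi> :: "'a \<times> 'a \<Rightarrow> real" where \<Phi>:
      "\<And>x s. \<bar>\<Phi> (x, s)\<bar> \<le> measure m K"
      "\<And>x y s. \<bar>\<Phi> (x, s) - \<Phi> (y, s)\<bar> \<le> translate_dist K x y"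
      "\<And>x. x \<in> insert 0 I \<Longrightarrow> c / 2 \<le> (\<Sum>s\<in>F. \<Phi> (s + x, s) - \<Phi> (x, s))"
      using finite_potential[OF K F _ _ c gap, of "insert 0 I"] I by blast
    then have "\<Phi> \<in> X" unfolding X_def by (auto simp: PiE_def)
    moreover have "\<Phi> \<in> (\<Inter>x\<in>I. Z x)" using \<Phi>(3) unfolding Z_def by blast
    ultimately show "X \<inter> (\<Inter>x\<in>I. Z x) \<noteq> {}" by blast
  qed
  then obtain \<Phi> where "\<Phi> \<in> X" and Z: "\<And>x. \<Phi> \<in> Z x" by blast
  then have "\<bar>\<Phi> (x, s)\<bar> \<le> measure m K" "\<bar>\<Phi> (x, s) - \<Phi> (y, s)\<bar> \<le> translate_dist K x y" for x y s
    unfolding X_def by (auto simp: PiE_def Pi_def)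
  then show thesis using Z by (intro that[of \<Phi>]) (auto simp: Z_def)
qed

text \<open>Left invariance of \<open>translate_dist\<close> carries the estimate at
  \<open>x\<close> to the origin, where it becomes small.\<close>

lemma continuous_of_translate_dist:
  fixes f :: "'a \<Rightarrow> real"
  assumes K: "compact K" and f: "\<And>x y. \<bar>f x - f y\<bar> \<le> translate_dist K x y"
  shows "continuous_on UNIV f"
proof (rule continuous_at_imp_continuous_on, rule ballI)
  fix x
  show "isCont f x"
    unfolding isCont_def
  proof (rule tendstoI)
    fix e :: real assume "e > 0"
    then obtain W where W: "open W" "0 \<in> W" "\<And>w. w \<in> W \<Longrightarrow> translate_dist K w 0 < e"
      using translate_dist_small[OF K] by blast
    have "open ((\<lambda>y. - x + y) -` W)" using W(1) by (intro open_vimage continuous_intros)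
    moreover have "x \<in> (\<lambda>y. - x + y) -` W" using W(2) by simp
    moreover have "dist (f y) (f x) < e" if "y \<in> (\<lambda>y. - x + y) -` W" for y
    proof -
      have "dist (f y) (f x) \<le> translate_dist K (x + (- x + y)) (x + 0)"
        using f[of y x] by (simp add: dist_real_def add.assoc[symmetric])
      also have "\<dots> = translate_dist K (- x + y) 0" by (rule translate_dist_add[OF K])
      also have "\<dots> < e" using that by (intro W) auto
      finally show ?thesis .
    qed
    ultimately show "eventually (\<lambda>y. dist (f y) (f x) < e) (at x)"
      unfolding eventually_at_topological by blast
  qed
qed

text \<open>A potential obtained by compactness is not measurable by construction; continuity is
  what supplies measurability.\<close>

lemma continuous_bounded_in_L_infinity:
  assumes "continuous_on UNIV \<phi>" "\<And>x. norm (\<phi> x) \<le> B"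
  shows "\<phi> \<in> L_infinity m"
proof -
  have "\<phi> \<in> borel_measurable m"
    using borel_measurable_continuous_onI[OF assms(1)] by simp
  then have "locally_measurable m \<phi>"
    unfolding locally_measurable_def by (auto intro: measurable_restrict_space1)
  moreover have "locally_AE m (\<lambda>x. norm (\<phi> x) \<le> B)"
    using assms(2) by (simp add: locally_AE_def)
  ultimately show ?thesis by (auto simp: L_infinity_def)
qed

text \<open>Otherwise there is a global potential. Each difference of a translate of it and itself
  has mean 0 by invariance, yet their sum is at least \<open>c / 2\<close> everywhere.\<close>

lemma amenable_imp_almost_invariant:
  assumes am: "amenable m" and K: "compact K" and F: "finite F" and c: "c > 0"
  shows "\<exists>Q a. finite Q \<and> (\<forall>x\<in>Q. a x \<ge> 0) \<and> sum a Q = (1 :: real) \<and> (\<Sum>s\<in>F. \<integral>y. \<bar>\<Sum>x\<in>Q.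
    a x * (indicator ((+) (s + x) ` K) y - indicator ((+) x ` K) y)\<bar> \<partial>m) < c"
proof (rule ccontr)
  assume contr: "\<not> ?thesis"
  have gap: "c \<le> (\<Sum>s\<in>F. \<integral>y. \<bar>\<Sum>x\<in>Q.
      a x * (indicator ((+) (s + x) ` K) y - indicator ((+) x ` K) y)\<bar> \<partial>m)"
    if "finite Q" "\<And>x. x \<in> Q \<Longrightarrow> a x \<ge> 0" "sum a Q = 1" for Q and a :: "'a \<Rightarrow> real"
    using contr that unfolding not_less[symmetric] by blast
  obtain \<Phi> :: "'a \<times> 'a \<Rightarrow> real" where \<Phi>:
    "\<And>x s. \<bar>\<Phi> (x, s)\<bar> \<le> measure m K"
    "\<And>x y s. \<bar>\<Phi> (x, s) - \<Phi> (y, s)\<bar> \<le> translate_dist K x y"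
    "\<And>x. c / 2 \<le> (\<Sum>s\<in>F. \<Phi> (s + x, s) - \<Phi> (x, s))"
    using global_potential[OF K F c gap] by blast
  obtain \<Lambda> where mean: "mean_on_L_infinity m \<Lambda>"
    and inv: "\<And>s \<phi>. \<phi> \<in> L_infinity m \<Longrightarrow> \<Lambda> (\<lambda>x. \<phi> (s + x)) = \<Lambda> \<phi>"
    using am unfolding amenable_def by blast
  note add = mean_add[OF mean] and scale = mean_scale[OF mean]
  define \<phi> where "\<phi> s x = complex_of_real (\<Phi> (x, s))" for s x
  have \<phi>: "\<phi> s \<in> L_infinity m" for s
  proof (rule continuous_bounded_in_L_infinity)
    have "continuous_on UNIV (\<lambda>x. \<Phi> (x, s))"
      by (rule continuous_of_translate_dist[OF K \<Phi>(2)])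
    then show "continuous_on UNIV (\<phi> s)"
      unfolding \<phi>_def[abs_def] by (rule continuous_on_of_real)
    show "norm (\<phi> s x) \<le> measure m K" for x using \<Phi>(1) by (simp add: \<phi>_def)
  qed
  define \<psi> where "\<psi> s x = \<phi> s (s + x) + (- 1) * \<phi> s x" for s x
  have \<psi>: "\<psi> s \<in> L_infinity m" for s
    unfolding \<psi>_def[abs_def] by (intro L_infinity_add L_infinity_scale L_infinity_translate \<phi>)
  have "\<Lambda> (\<psi> s) = 0" for s
  proof -
    have "\<Lambda> (\<psi> s) = \<Lambda> (\<lambda>x. \<phi> s (s + x)) + \<Lambda> (\<lambda>x. (- 1) * \<phi> s x)"
      unfolding \<psi>_def[abs_def] by (intro add L_infinity_scale L_infinity_translate \<phi>)
    also have "\<Lambda> (\<lambda>x. (- 1) * \<phi> s x) = (- 1) * \<Lambda> (\<phi> s)" by (rule scale[OF \<phi>])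
    finally show ?thesis using inv[OF \<phi>] by simp
  qed
  then have sum0: "(\<lambda>x. \<Sum>s\<in>F. \<psi> s x) \<in> L_infinity m" "\<Lambda> (\<lambda>x. \<Sum>s\<in>F. \<psi> s x) = 0"
    using mean_sum[OF mean F, of \<psi>] \<psi> by auto
  \<comment> \<open>Subtracting the lower bound leaves a nonnegative function whose mean is the
    negative number \<open>b\<close>.\<close>
  define b where "b = complex_of_real (- (c / 2))"
  have "\<Lambda> (\<lambda>x. (\<Sum>s\<in>F. \<psi> s x) + b * 1) = \<Lambda> (\<lambda>x. \<Sum>s\<in>F. \<psi> s x) + \<Lambda> (\<lambda>x. b * 1)"
    by (intro add sum0 L_infinity_const)
  also have "\<Lambda> (\<lambda>x. b * 1) = b * \<Lambda> (\<lambda>x. 1)" by (intro scale L_infinity_const)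
  also have "\<Lambda> (\<lambda>x. 1) = 1" using mean by (simp add: mean_on_L_infinity_def)
  finally have \<Lambda>_b: "\<Lambda> (\<lambda>x. (\<Sum>s\<in>F. \<psi> s x) + b * 1) = b" by (simp add: sum0)
  have "(\<Sum>s\<in>F. \<psi> s x) + b * 1 \<in> \<real>\<^sub>\<ge>\<^sub>0" for x
  proof -
    have "(\<Sum>s\<in>F. \<psi> s x) + b * 1 = complex_of_real ((\<Sum>s\<in>F. \<Phi> (s + x, s) - \<Phi> (x, s)) - c / 2)"
      by (simp add: \<psi>_def \<phi>_def b_def)
    then show ?thesis using \<Phi>(3)[of x] by (simp only: nonneg_Reals_of_real_iff)
  qed
  then have "locally_AE m (\<lambda>x. (\<Sum>s\<in>F. \<psi> s x) + b * 1 \<in> \<real>\<^sub>\<ge>\<^sub>0)" by (simp add: locally_AE_def)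
  moreover have "(\<lambda>x. (\<Sum>s\<in>F. \<psi> s x) + b * 1) \<in> L_infinity m"
    by (intro L_infinity_add sum0 L_infinity_const)
  ultimately have "b \<in> \<real>\<^sub>\<ge>\<^sub>0"
    using mean \<Lambda>_b unfolding mean_on_L_infinity_def by metis
  then show False using c by (simp add: b_def complex_nonneg_Reals_iff)
qed

end

section \<open>Foelner sets\<close>

context haar
begin

text \<open>The value at \<open>y\<close> depends only on which translates contain \<open>y\<close>,
  so the superlevel set is a finite union of finite intersections of translates.\<close>

lemma compact_superlevel:
  fixes a :: "'a \<Rightarrow> real"
  assumes K: "compact K" and Q: "finite Q" and a: "\<And>x. x \<in> Q \<Longrightarrow> a x \<ge> 0" and t: "t > 0"
  shows "compact {y. t \<le> (\<Sum>x\<in>Q. a x * indicator ((+) x ` K) y)}"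
proof -
  let ?T = "{T. T \<subseteq> Q \<and> t \<le> sum a T}"
  have "{y. t \<le> (\<Sum>x\<in>Q. a x * indicator ((+) x ` K) y)} = (\<Union>T\<in>?T. \<Inter>x\<in>T. (+) x ` K)"
  proof (intro set_eqI iffI)
    fix y assume "y \<in> {y. t \<le> (\<Sum>x\<in>Q. a x * indicator ((+) x ` K) y)}"
    moreover have "(\<Sum>x\<in>Q. a x * indicator ((+) x ` K) y) = sum a {x\<in>Q. y \<in> (+) x ` K}"
      using Q by (simp add: indicator_def sum.If_cases Int_def if_distrib cong: if_cong)
    ultimately have "{x\<in>Q. y \<in> (+) x ` K} \<in> ?T" by auto
    then show "y \<in> (\<Union>T\<in>?T. \<Inter>x\<in>T. (+) x ` K)" by (rule UN_I) auto
  next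
    fix y assume "y \<in> (\<Union>T\<in>?T. \<Inter>x\<in>T. (+) x ` K)"
    then obtain T where T: "T \<subseteq> Q" "t \<le> sum a T" "\<And>x. x \<in> T \<Longrightarrow> y \<in> (+) x ` K" by blast
    note T(2)
    also have "sum a T = (\<Sum>x\<in>T. a x * indicator ((+) x ` K) y)"
      using T(3) by (intro sum.cong) auto
    also have "\<dots> \<le> (\<Sum>x\<in>Q. a x * indicator ((+) x ` K) y)"
      using Q T(1) a by (intro sum_mono2) auto
    finally show "y \<in> {y. t \<le> (\<Sum>x\<in>Q. a x * indicator ((+) x ` K) y)}" by simp
  qed
  moreover have "compact (\<Union>T\<in>?T. \<Inter>x\<in>T. (+) x ` K)"
  proof (rule compact_UN)
    show "finite ?T" by (rule finite_subset[of _ "Pow Q"]) (use Q in auto)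
    fix T assume "T \<in> ?T"
    \<comment> \<open>Positivity of \<open>t\<close> excludes empty \<open>T\<close>, for which the
      intersection would be the whole group.\<close>
    then obtain x where "x \<in> T" using t by fastforce
    then have "(\<Inter>x\<in>T. (+) x ` K) = (+) x ` K \<inter> (\<Inter>x\<in>T. (+) x ` K)" by blast
    also have "compact \<dots>"
      using K by (intro compact_Int_closed closed_INT ballI compact_translate compact_imp_closed)
    finally show "compact (\<Inter>x\<in>T. (+) x ` K)" .
  qed
  ultimately show ?thesis by simp
qed

text \<open>Layer-cake argument with \<open>N\<close> equally spaced levels of \<open>f\<close>: up
  to rounding, the measures of the level sets add up to \<open>N\<close> times the integral of
  \<open>f\<close>, and those of their boundary parts to at most \<open>N\<close> times the
  displacement \<open>A\<close>. Since \<open>A\<close> is the smaller one, some level set works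
  once \<open>N\<close> is large.\<close>

lemma almost_invariant_imp_folner_set:
  fixes a :: "'a \<Rightarrow> real"
  assumes K: "compact K" and F: "finite F" and Q: "finite Q"
    and a: "\<And>x. x \<in> Q \<Longrightarrow> a x \<ge> 0" "sum a Q = 1"
    and inv: "(\<Sum>s\<in>F. \<integral>y. \<bar>\<Sum>x\<in>Q. a x *
      (indicator ((+) (s + x) ` K) y - indicator ((+) x ` K) y)\<bar> \<partial>m) < measure m K"
  shows "\<exists>C. compact C \<and> (\<Sum>s\<in>F. measure m ((+) s ` C - C)) < measure m C"
proof (rule ccontr)
  assume contr: "\<not> ?thesis"
  define f where "f y = (\<Sum>x\<in>Q. a x * indicator ((+) x ` K) y)" for y
  have f_shift: "f (- s + y) = (\<Sum>x\<in>Q. a x * indicator ((+) (s + x) ` K) y)" for s y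
    by (simp add: f_def indicator_translate)
  have f: "test_fun f" unfolding f_def[abs_def]
    by (intro test_fun_intros test_fun_indicator_translate K)
  have f0: "f y \<ge> 0" for y unfolding f_def using a by (intro sum_nonneg) auto
  have "f y \<le> (\<Sum>x\<in>Q. a x * 1)" for y
    unfolding f_def using a by (intro sum_mono mult_left_mono) (auto simp: indicator_def)
  then have f1: "f y \<le> 1" for y using a by simp
  have "(\<integral>y. f y \<partial>m) = (\<Sum>x\<in>Q. a x * measure m K)"
    unfolding f_def using K
    by (subst Bochner_Integration.integral_sum)
      (auto intro!: test_fun_integrable test_fun_scale test_fun_indicator_translate
        simp: measure_translate compact_borel)
  then have int_f: "(\<integral>y. f y \<partial>m) = measure m K"
    using a by (simp add: sum_distrib_right[symmetric])
  \<comment> \<open>Outside \<open>L\<close> both \<open>f\<close> and its translates by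
    \<open>F\<close> vanish, which confines the rounding errors to a set of finite measure.\<close>
  define L where "L = (\<Union>x\<in>Q. (+) x ` K) \<union> (\<Union>s\<in>F. \<Union>x\<in>Q. (+) (s + x) ` K)"
  have L: "compact L" unfolding L_def using Q F K by (intro compact_Un compact_UN compact_translate)
  have f_L: "f y = 0" if "y \<notin> L" for y
    unfolding f_def using that by (intro sum.neutral) (auto simp: L_def indicator_def)
  have f_L': "f (- s + y) = 0" if "y \<notin> L" "s \<in> F" for s y
    unfolding f_shift using that by (intro sum.neutral) (auto simp: L_def indicator_def)
  define A where "A = (\<Sum>s\<in>F. \<integral>y. \<bar>f (- s + y) - f y\<bar> \<partial>m)"
  have A: "A < measure m K"
    unfolding A_def f_shift using inv
    by (simp add: f_def sum_subtractf[symmetric] right_diff_distrib)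
  \<comment> \<open>One rounding error comes from the lower estimate and one from each
    \<open>s \<in> F\<close>. The right-hand side does not depend on \<open>N\<close>.\<close>
  have bound: "real N * (measure m K - A) \<le> (real (card F) + 1) * measure m L" for N
  proof -
    define C where "C k = {y. real k \<le> real N * f y}" for k
    \<comment> \<open>Levels start at 1: as \<open>f\<close> is nonnegative, \<open>C 0\<close>
      would be the whole group.\<close>
    have C_compact: "compact (C k)" if "k \<in> {1..N}" for k
    proof -
      have "C k = {y. real k / real N \<le> f y}"
        using that by (auto simp: C_def field_simps)
      then show ?thesis
        using compact_superlevel[OF K Q a(1), where t="real k / real N"] that by (simp add: f_def)
    qed
    have C_diff: "y \<in> (+) s ` C k - C k \<longleftrightarrow>
        real k \<le> real N * f (- s + y) \<and> \<not> real k \<le> real N * f y" for s k y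
      by (simp add: C_def image_add_eq_vimage)
    have C_test: "test_fun (indicator (C k))" "test_fun (indicator ((+) s ` C k - C k))"
      if "k \<in> {1..N}" for k s
      using C_compact[OF that]
      by (simp_all add: test_fun_indicator compact_fmeasurable fmeasurable.Diff compact_translate)
    have up: "(\<Sum>k=1..N. measure m ((+) s ` C k - C k)) \<le>
        real N * (\<integral>y. \<bar>f (- s + y) - f y\<bar> \<partial>m) + measure m L" if s: "s \<in> F" for s
    proof -
      have "(\<Sum>k=1..N. measure m ((+) s ` C k - C k))
          = (\<integral>y. (\<Sum>k=1..N. indicator ((+) s ` C k - C k) y) \<partial>m)"
        using C_test by (subst Bochner_Integration.integral_sum) (auto intro: test_fun_integrable)
      also have "\<dots> \<le> (\<integral>y. real N * \<bar>f (- s + y) - f y\<bar> + indicator L y \<partial>m)"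
      proof (intro integral_mono test_fun_integrable test_fun_intros test_fun_translate[OF f] f
          C_test test_fun_indicator compact_fmeasurable L)
        fix y
        have "(\<Sum>k=1..N. indicator ((+) s ` C k - C k) y) = (\<Sum>k=1..N.
            of_bool (real k \<le> real N * f (- s + y) \<and> \<not> real k \<le> real N * f y) :: real)"
          by (intro sum.cong refl) (simp only: indicator_def C_diff)
        also have "\<dots> \<le> real N * \<bar>f (- s + y) - f y\<bar> + indicator L y"
        proof (cases "y \<in> L")
          case True
          then show ?thesis using levels_difference_le[OF f0 f0, of N] by simp
        next
          case False
          then show ?thesis using f_L f_L' s by simp
        qed
        finally show "(\<Sum>k=1..N. indicator ((+) s ` C k - C k) y)
          \<le> real N * \<bar>f (- s + y) - f y\<bar> + indicator L y" .
      qed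
      also have "\<dots> = (\<integral>y. real N * \<bar>f (- s + y) - f y\<bar> \<partial>m) + (\<integral>y. indicator L y \<partial>m)"
        by (intro Bochner_Integration.integral_add test_fun_integrable test_fun_intros
            test_fun_translate[OF f] f test_fun_indicator compact_fmeasurable L)
      finally show ?thesis by simp
    qed
    have low: "real N * measure m K - measure m L \<le> (\<Sum>k=1..N. measure m (C k))"
    proof -
      have "(\<integral>y. real N * f y \<partial>m) - (\<integral>y. indicator L y \<partial>m) = (\<integral>y. real N * f y - indicator L y \<partial>m)"
        by (intro Bochner_Integration.integral_diff[symmetric] test_fun_integrable test_fun_intros f
            test_fun_indicator compact_fmeasurable L)
      also have "\<dots> \<le> (\<integral>y. (\<Sum>k=1..N. indicator (C k) y) \<partial>m)"
      proof (intro integral_mono test_fun_integrable test_fun_intros f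
          C_test test_fun_indicator compact_fmeasurable L)
        fix y
        show "real N * f y - indicator L y \<le> (\<Sum>k=1..N. indicator (C k) y)"
        proof (cases "y \<in> L")
          case True
          have "(\<Sum>k=1..N. indicator (C k) y) = (\<Sum>k=1..N. of_bool (real k \<le> real N * f y) :: real)"
            by (intro sum.cong refl) (simp add: indicator_def C_def)
          then show ?thesis using True levels_ge[OF f0 f1, of N y] by simp
        next
          case False
          then show ?thesis using f_L by (simp add: sum_nonneg)
        qed
      qed
      also have "\<dots> = (\<Sum>k=1..N. measure m (C k))"
        using C_test by (subst Bochner_Integration.integral_sum) (auto intro: test_fun_integrable)
      finally show ?thesis by (simp add: int_f)
    qed
    note low
    \<comment> \<open>The assumption that no compact set is a Foelner set is applied at every
      level.\<close>
    also have "(\<Sum>k=1..N. measure m (C k)) \<le> (\<Sum>k=1..N. \<Sum>s\<in>F. measure m ((+) s ` C k - C k))"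
      using contr C_compact by (intro sum_mono) (auto simp: not_less)
    also have "\<dots> = (\<Sum>s\<in>F. \<Sum>k=1..N. measure m ((+) s ` C k - C k))" by (rule sum.swap)
    also have "\<dots> \<le> (\<Sum>s\<in>F. real N * (\<integral>y. \<bar>f (- s + y) - f y\<bar> \<partial>m) + measure m L)"
      by (intro sum_mono up)
    also have "\<dots> = real N * A + real (card F) * measure m L"
      by (simp add: sum.distrib A_def sum_distrib_left)
    finally show ?thesis by (simp add: algebra_simps)
  qed
  obtain N where "(real (card F) + 1) * measure m L / (measure m K - A) < real N"
    using reals_Archimedean2 by blast
  then have "(real (card F) + 1) * measure m L < real N * (measure m K - A)"
    using A by (simp add: pos_divide_less_eq)
  with bound[of N] show False by simp
qed

lemma folner_set_imp_small_unions:
  assumes C: "compact C" and F: "finite F" and E: "E \<subseteq> F"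
    and fol: "(\<Sum>s\<in>F. measure m ((+) s ` C - C)) < measure m C"
  shows "measure m (E + C) < 2 * measure m C"
proof -
  have finE: "finite E" using E F by (rule finite_subset)
  have fm: "(+) s ` C - C \<in> fmeasurable m" "C \<in> fmeasurable m" for s
    using C by (simp_all add: compact_fmeasurable fmeasurable.Diff compact_translate)
  have fmU: "(\<Union>s\<in>E. (+) s ` C - C) \<in> fmeasurable m"
    using finE fm by (intro fmeasurable.finite_UN) auto
  have "E + C \<subseteq> C \<union> (\<Union>s\<in>E. (+) s ` C - C)" unfolding set_plus_eq_UN by blast
  moreover have "E + C \<in> sets m"
    unfolding set_plus_eq_UN using finE C
    by (auto intro!: sets.finite_UN compact_borel compact_translate)
  ultimately have "measure m (E + C) \<le> measure m (C \<union> (\<Union>s\<in>E. (+) s ` C - C))"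
    by (intro measure_mono_fmeasurable fmeasurable.Un fm fmU)
  also have "\<dots> \<le> measure m C + measure m (\<Union>s\<in>E. (+) s ` C - C)"
    by (intro measure_Un_le fmeasurableD fm fmU)
  also have "measure m (\<Union>s\<in>E. (+) s ` C - C) \<le> (\<Sum>s\<in>E. measure m ((+) s ` C - C))"
    by (intro measure_UNION_le fmeasurableD finE fm)
  also have "\<dots> \<le> (\<Sum>s\<in>F. measure m ((+) s ` C - C))"
    using F E by (intro sum_mono2) auto
  finally show ?thesis using fol by simp
qed

lemma amenable_imp_folner_set:
  assumes "amenable m" "finite F"
  shows "\<exists>C. compact C \<and> (\<Sum>s\<in>F. measure m ((+) s ` C - C)) < measure m C"
proof -
  obtain K where K: "compact K" "measure m K > 0" using exists_compact_pos by blast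
  from amenable_imp_almost_invariant[OF assms(1) K(1) assms(2) K(2)]
  show ?thesis by (elim exE conjE) (rule almost_invariant_imp_folner_set[OF K(1) assms(2)], auto)
qed

end

text \<open>As \<open>E\<close> is finite and \<open>C\<close> compact, \<open>E + C\<close> is
  compact and has finite measure, so the real-valued \<open>measure\<close> loses nothing.\<close>

theorem mainTheorem1:
  fixes m :: "'a::{topological_group_add, t2_space} measure"
  assumes "locally_compact_space (euclidean :: 'a topology)"
    and "left_haar_measure m"
  shows "amenable m \<longleftrightarrow>
    (\<forall>\<epsilon>::real. \<epsilon> > 0 \<longrightarrow>
      (\<exists>n::nat. n \<ge> 1 \<and>
        (\<forall>F::'a set. finite F \<longrightarrow>
          (\<exists>C::'a set. compact C \<and>
            (\<forall>E. E \<subseteq> F \<and> card E \<ge> n \<longrightarrow>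
              measure m (E + C) < \<epsilon> * real (card E) * measure m C)))))"
proof -
  interpret haar m using assms(2) by unfold_locales
  show ?thesis
  proof (intro iffI allI impI)
    fix \<epsilon> :: real assume am: "amenable m" and \<epsilon>: "\<epsilon> > 0"
    \<comment> \<open>The factor 2 in the Foelner bound is at most
      \<open>\<epsilon> * real n\<close> once \<open>n\<close> exceeds
      \<open>2 / \<epsilon>\<close>; this \<open>n\<close> serves all \<open>F\<close>.\<close>
    obtain k where k: "2 / \<epsilon> < real k" using reals_Archimedean2 by blast
    define n where "n = max 1 k"
    have "2 / \<epsilon> < real n" using k by (simp add: n_def)
    then have n: "2 \<le> \<epsilon> * real n" using \<epsilon> by (simp add: field_simps)
    have "\<exists>C. compact C \<and> (\<forall>E. E \<subseteq> F \<and> card E \<ge> n \<longrightarrow>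
        measure m (E + C) < \<epsilon> * real (card E) * measure m C)" if F: "finite F" for F
    proof -
      obtain C where C: "compact C" and fol: "(\<Sum>s\<in>F. measure m ((+) s ` C - C)) < measure m C"
        using amenable_imp_folner_set[OF am F] by blast
      have "measure m (E + C) < \<epsilon> * real (card E) * measure m C" if "E \<subseteq> F" "card E \<ge> n" for E
      proof -
        have "measure m (E + C) < 2 * measure m C"
          by (rule folner_set_imp_small_unions[OF C F that(1) fol])
        also have "\<dots> \<le> \<epsilon> * real n * measure m C" using n by (intro mult_right_mono) auto
        also have "\<dots> \<le> \<epsilon> * real (card E) * measure m C"
          using that(2) \<epsilon> by (intro mult_right_mono mult_left_mono) auto
        finally show ?thesis .
      qed
      with C show ?thesis by blast
    qed
    moreover have "n \<ge> 1" by (simp add: n_def)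
    ultimately show "\<exists>n\<ge>1. \<forall>F. finite F \<longrightarrow> (\<exists>C. compact C \<and> (\<forall>E. E \<subseteq> F \<and> card E \<ge> n \<longrightarrow>
        measure m (E + C) < \<epsilon> * real (card E) * measure m C))" by blast
  next
    assume "\<forall>\<epsilon>::real. \<epsilon> > 0 \<longrightarrow> (\<exists>n\<ge>1. \<forall>F::'a set. finite F \<longrightarrow> (\<exists>C. compact C \<and>
      (\<forall>E. E \<subseteq> F \<and> card E \<ge> n \<longrightarrow> measure m (E + C) < \<epsilon> * real (card E) * measure m C)))"
    from this[rule_format, of "1 / 2"] obtain n where n: "n \<ge> 1"
      and small: "\<And>F :: 'a set. finite F \<Longrightarrow> \<exists>C. compact C \<and> (\<forall>E. E \<subseteq> F \<and> card E \<ge> n \<longrightarrow>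
        measure m (E + C) < 1 / 2 * real (card E) * measure m C)"
      by auto
    have reiter_condition
    proof (rule overlap_imp_reiter[OF n, of "1 / real n"])
      fix F :: "'a set" assume F: "finite F"
      obtain C where "compact C" "\<And>E. E \<subseteq> F \<Longrightarrow> card E \<ge> n \<Longrightarrow>
          measure m (E + C) < 1 / 2 * real (card E) * measure m C"
        using small[OF F] by blast
      then show "\<exists>C E. compact C \<and> measure m C > 0 \<and> finite E \<and> card E \<le> n \<and>
          (\<forall>s\<in>F. \<exists>t\<in>E. measure m ((+) s ` C \<inter> (+) t ` C) \<ge> 1 / real n * measure m C)"
        by (rule small_unions_imp_overlap[OF n F])
    qed (use n in simp)
    then show "amenable m" by (rule reiter_imp_amenable)
  qed
qed

end
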